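(* Let $D\ge2$ be squarefree, $K=\mathbb{Q}(\sqrt D)$, and let $\alpha \in \mathcal{O}_K^+$, $j\in\mathbb{Z}$, $e\in\mathbb{Z}_{\ge1}$, $f\in\mathbb{Z}_{\ge0}$ with $\alpha=e\beta_j+f\beta_{j+1}$. Then $p_K(\alpha\,|\,\mathcal{I})=2$ if and only if one of the following holds: (1) $v_j\le e\le 2v_j-1$, $0\le f\le v_{j+1}-2$, and $(e,f)\ne(2v_j-1,v_{j+1}-2)$, $(v_{j-1},e)\ne(2,2v_j-1)$, $(v_{j-1},e,f)\ne(2,2v_j-2,v_{j+1}-2)$; (2) $1\le e\le v_j-2$, $v_{j+1}\le f\le 2v_{j+1}-1$, and $(e,f)\ne(v_j-2,2v_{j+1}-1)$, $(f,v_{j+2})\ne(2v_{j+1}-1,2)$, $(e,f,v_{j+2})\ne(v_j-2,2v_{j+1}-2,2)$; (3) $e=v_j-1$, $f=v_{j+1}-1$, and $(v_{j-1},v_j,v_{j+1},v_{j+2})\ne(2,2,2,2)$.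
   Context: $\mathcal{O}_K^+$: totally positive integers of $K$; $\alpha'$ denotes the Galois conjugate. $\alpha\in\mathcal{O}_K^+$ is indecomposable if it is not a sum of two elements of $\mathcal{O}_K^+$. $p_K(\alpha\,|\,\mathcal{I})$ is the number of unordered representations $\alpha=\lambda_1+\dots+\lambda_\ell$ ($\ell\ge1$) with all $\lambda_i$ indecomposable. Notation: $\omega_D=\sqrt D$, $\xi_D=\sqrt D$ if $D\equiv2,3\pmod4$; $\omega_D=(1+\sqrt D)/2$, $\xi_D=(\sqrt D-1)/2$ if $D\equiv1\pmod4$. Write $\omega_D=[\lceil u_0/2\rceil;\overline{u_1,\dots,u_s}]$ with $u_s=u_0$ (indices extended periodically). Let $p_{-1}=1,q_{-1}=0$, $p_0=\lceil u_0/2\rceil$, $q_0=1$, $p_{i+2}=u_{i+2}p_{i+1}+p_i$, $q_{i+2}=u_{i+2}q_{i+1}+q_i$; put $\alpha_i=p_i+q_i\xi_D$ and $\alpha_{i,r}=\alpha_i+r\alpha_{i+1}$ (so $\alpha_{i,u_{i+2}}=\alpha_{i+2,0}$ and $\alpha_{-1,0}=1$). The indecomposables of $\mathcal{O}_K^+$ are exactly the $\alpha_{i,r}$ with $i\ge-1$ odd, $0\le r\le u_{i+2}-1$, and their conjugates. They are ordered as a two-sided sequence $\dots<\beta_{-1}<\beta_0=1<\beta_1<\dots$ with $\beta_{-j}=\beta_j'$ (for $j\ge0$, $\beta_j$ runs through the $\alpha_{i,r}$ in lexicographic order of $(i,r)$). For $j\in\mathbb{Z}$ set $v_j=2$ if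 $\beta_{|j|}=\alpha_{i,r}$ with $1\le r\le u_{i+2}-1$, and $v_j=u_{i+1}+2$ if $\beta_{|j|}=\alpha_{i,0}$ ($i\ge-1$ odd); then $v_j\beta_j=\beta_{j-1}+\beta_{j+1}$ for all $j$. Every $\alpha\in\mathcal{O}_K^+$ has a unique expression $\alpha=e\beta_j+f\beta_{j+1}$ with $j\in\mathbb{Z}$, $e\ge1$, $f\ge0$. *)

theory Defs
  imports Complex_Main
    "HOL-Library.Multiset"
    "HOL-Computational_Algebra.Polynomial"
    "HOL-Computational_Algebra.Squarefree"
begin

text \<open>
  Throughout, \<open>D \<ge> 2\<close> is a squarefree natural number, and the real quadratic field
  \<open>K = \<rat>(\<surd>D)\<close> is regarded as a subset of \<open>\<real>\<close>.
\<close>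

definition quad_field :: "nat \<Rightarrow> real set" where
  "quad_field D = {a + b * sqrt (real D) | a b. a \<in> \<rat> \<and> b \<in> \<rat>}"

definition ring_of_ints :: "nat \<Rightarrow> real set" where
  "ring_of_ints D = {x \<in> quad_field D. algebraic_int x}"

text \<open>
  The Galois conjugate. For squarefree \<open>D \<ge> 2\<close> the rational coordinates \<open>a\<close>, \<open>b\<close> are unique, so the
  description determines a unique value on \<open>quad_field D\<close>; off the field it is unspecified.
\<close>

definition conjugate :: "nat \<Rightarrow> real \<Rightarrow> real" where
  "conjugate D x = (THE y. \<exists>a\<in>\<rat>. \<exists>b\<in>\<rat>. x = a + b * sqrt (real D) \<and> y = a - b * sqrt (real D))"

definition totally_positive_ints :: "nat \<Rightarrow> real set" where
  "totally_positive_ints D = {x \<in> ring_of_ints D. x > 0 \<and> conjugate D x > 0}"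

definition indecomposables :: "nat \<Rightarrow> real set" where
  "indecomposables D =
     {x \<in> totally_positive_ints D.
        \<not> (\<exists>y\<in>totally_positive_ints D. \<exists>z\<in>totally_positive_ints D. x = y + z)}"

text \<open>
  The number of unordered representations of \<open>x\<close> as a sum of at least one element of \<open>A\<close>, with
  repetition allowed; \<open>p\<^sub>K(\<alpha> | \<I>)\<close> is \<open>num_partitions (indecomposables D) \<alpha>\<close>.
  As usual \<open>card\<close> is \<open>0\<close> on an infinite set of representations.
\<close>

definition num_partitions :: "real set \<Rightarrow> real \<Rightarrow> nat" where
  "num_partitions A x = card {M :: real multiset. M \<noteq> {#} \<and> set_mset M \<subseteq> A \<and> sum_mset M = x}"

definition omega :: "nat \<Rightarrow> real" where
  "omega D = (if D mod 4 = 1 then (1 + sqrt (real D)) / 2 else sqrt (real D))"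

definition xi :: "nat \<Rightarrow> real" where
  "xi D = (if D mod 4 = 1 then (sqrt (real D) - 1) / 2 else sqrt (real D))"

text \<open>
  Simple continued fraction of an irrational \<open>x\<close>: complete quotients and partial quotients.
\<close>

primrec complete_quotient :: "real \<Rightarrow> nat \<Rightarrow> real" where
  "complete_quotient x 0 = x"
| "complete_quotient x (Suc n) = 1 / (complete_quotient x n - \<lfloor>complete_quotient x n\<rfloor>)"

definition partial_quotient :: "real \<Rightarrow> nat \<Rightarrow> int" where
  "partial_quotient x n = \<lfloor>complete_quotient x n\<rfloor>"

text \<open>
  The length \<open>s\<close> of the period in \<open>\<omega>\<^sub>D = [\<lceil>u\<^sub>0/2\<rceil>; u\<^sub>1, \<dots>, u\<^sub>s, u\<^sub>1, \<dots>]\<close>. The pre-period consists of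
  the zeroth term only, and that term is not \<open>u\<^sub>0\<close>: the number \<open>u\<^sub>0\<close> is defined to be \<open>u\<^sub>s\<close>.
\<close>

definition period :: "nat \<Rightarrow> nat" where
  "period D = (LEAST s. s \<ge> 1 \<and>
     (\<forall>i\<ge>1. partial_quotient (omega D) (i + s) = partial_quotient (omega D) i))"

definition u_coeff :: "nat \<Rightarrow> nat \<Rightarrow> int" where
  "u_coeff D i = partial_quotient (omega D) (if i = 0 then period D else i)"

text \<open>
  The sequences \<open>p\<^sub>i\<close>, \<open>q\<^sub>i\<close> start at \<open>i = -1\<close>; the auxiliary functions are shifted by one, so that
  \<open>p_shift D n\<close> is \<open>p\<^bsub>n-1\<^esub>\<close>. The functions indexed by \<open>int\<close> are meaningful for \<open>i \<ge> -1\<close> only.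
\<close>

fun p_shift :: "nat \<Rightarrow> nat \<Rightarrow> int" where
  "p_shift D 0 = 1"
| "p_shift D (Suc 0) = \<lceil>real_of_int (u_coeff D 0) / 2\<rceil>"
| "p_shift D (Suc (Suc n)) = u_coeff D (Suc n) * p_shift D (Suc n) + p_shift D n"

fun q_shift :: "nat \<Rightarrow> nat \<Rightarrow> int" where
  "q_shift D 0 = 0"
| "q_shift D (Suc 0) = 1"
| "q_shift D (Suc (Suc n)) = u_coeff D (Suc n) * q_shift D (Suc n) + q_shift D n"

definition alpha :: "nat \<Rightarrow> int \<Rightarrow> real" where
  "alpha D i = of_int (p_shift D (nat (i + 1))) + of_int (q_shift D (nat (i + 1))) * xi D"

definition alpha2 :: "nat \<Rightarrow> int \<Rightarrow> int \<Rightarrow> real" where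
  "alpha2 D i r = alpha D i + of_int r * alpha D (i + 1)"

text \<open>
  The pairs \<open>(i, r)\<close> with \<open>i \<ge> -1\<close> odd and \<open>0 \<le> r \<le> u\<^bsub>i+2\<^esub> - 1\<close>, enumerated in lexicographic
  order starting from \<open>(-1, 0)\<close>.
\<close>

primrec index_pair :: "nat \<Rightarrow> nat \<Rightarrow> int \<times> int" where
  "index_pair D 0 = (-1, 0)"
| "index_pair D (Suc n) =
     (case index_pair D n of (i, r) \<Rightarrow>
        if r + 1 \<le> u_coeff D (nat (i + 2)) - 1 then (i, r + 1) else (i + 2, 0))"

definition beta :: "nat \<Rightarrow> int \<Rightarrow> real" where
  "beta D j =
     (let b = (case index_pair D (nat \<bar>j\<bar>) of (i, r) \<Rightarrow> alpha2 D i r)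
      in if j \<ge> 0 then b else conjugate D b)"

definition v_coeff :: "nat \<Rightarrow> int \<Rightarrow> int" where
  "v_coeff D j =
     (case index_pair D (nat \<bar>j\<bar>) of (i, r) \<Rightarrow> if r = 0 then u_coeff D (nat (i + 1)) + 2 else 2)"

end

theory Submission
  imports Defs
begin

text \<open>
  The counting only uses that the \<open>\<beta> j\<close> satisfy \<open>v j * \<beta> j = \<beta> (j - 1) + \<beta> (j + 1)\<close> with \<open>v j \<ge> 2\<close> and
  that \<open>\<beta> 0\<close>, \<open>\<beta> 1\<close> are linearly independent. In the coordinates with respect to \<open>\<beta> j\<close>,
  \<open>\<beta> (j + 1)\<close>, every summand \<open>\<beta> k\<close> outside the cone is a positive multiple of one basis vector minus a
  positive multiple of the other, and convexity of linear functionals along the sequence bounds the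
  first coefficient below in terms of the second. Adding up the summands left and right of the cone
  leaves only a few possible representations.

  That the \<open>\<beta> j\<close> behave like this and are all the indecomposables rests on the pure periodicity of
  the continued fraction of \<open>\<lfloor>\<omega>\<rfloor> + \<xi>\<close>, a reduced quadratic irrational: it gives
  \<open>u\<^sub>0 = 2 * \<lfloor>\<omega>\<rfloor> - Tr \<omega>\<close>, hence the recurrence across \<open>j = 0\<close>. An element is located in a cone by the
  sign change of its coordinate sequence, which is a determinant against \<open>\<beta> (j + 1)\<close>.
\<close>

section \<open>Sums of elements of a two-sided convex sequence\<close>

lemma card_ne_2:
  assumes "x \<in> S" "y \<in> S" "z \<in> S" "x \<noteq> y" "x \<noteq> z" "y \<noteq> z"
  shows "card S \<noteq> 2"
  using assms by (auto simp: card_2_iff)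

locale beta_chain =
  fixes \<beta> :: "int \<Rightarrow> real" and v :: "int \<Rightarrow> int"
  assumes v_ge_2: "v j \<ge> 2"
    and recurrence: "of_int (v j) * \<beta> j = \<beta> (j - 1) + \<beta> (j + 1)"
    and independent_0: "of_int a * \<beta> 0 + of_int b * \<beta> 1 = 0 \<Longrightarrow> a = 0 \<and> b = 0"
begin

lemma beta_next: "\<beta> (j + 2) = of_int (v (j + 1)) * \<beta> (j + 1) - \<beta> j"
  using recurrence[of "j + 1"] by (simp add: add.commute)

lemma beta_prev: "\<beta> (j - 1) = of_int (v j) * \<beta> j - \<beta> (j + 1)"
  using recurrence[of j] by simp

text \<open>The recurrence rewrites a relation between two neighbours as an integer relation between
  the adjacent pair, so independence spreads from \<open>0\<close> in both directions.\<close>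

lemma independent:
  "of_int a * \<beta> j + of_int b * \<beta> (j + 1) = 0 \<Longrightarrow> a = 0 \<and> b = 0"
proof (induction j arbitrary: a b rule: int_induct[where k = 0])
  case base
  then show ?case using independent_0[of a b] by simp
next
  case (step1 j)
  have "of_int (-b) * \<beta> j + of_int (a + b * v (j + 1)) * \<beta> (j + 1) = 0"
    using step1.prems beta_next[of j] by (simp add: algebra_simps)
  from step1.IH[OF this] show ?case by auto
next
  case (step2 j)
  have "of_int (a * v j + b) * \<beta> j + of_int (- a) * \<beta> (j + 1) = 0"
    using step2.prems beta_prev[of j] by (simp add: algebra_simps)
  from step2.IH[OF this] show ?case by auto
qed

lemma coords_unique:
  assumes "of_int a * \<beta> j + of_int b * \<beta> (j + 1) = of_int a' * \<beta> j + of_int b' * \<beta> (j + 1)"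
  shows "a = a' \<and> b = b'"
  using assms independent[of "a - a'" j "b - b'"] by (simp add: algebra_simps)

text \<open>Reflection turns the terms right of the cone at \<open>j\<close> into terms left of the
  cone at \<open>- (j + 1)\<close>, so only one side has to be analysed.\<close>

lemma mirror: "beta_chain (\<lambda>k. \<beta> (- k)) (\<lambda>k. v (- k))"
proof
  fix a b j :: int
  show "v (- j) \<ge> 2" by (rule v_ge_2)
  show "of_int (v (- j)) * \<beta> (- j) = \<beta> (- (j - 1)) + \<beta> (- (j + 1))"
  proof -
    have "- (j - 1) = - j + 1" "- (j + 1) = - j - 1" by simp_all
    with recurrence[of "- j"] show ?thesis by (metis add.commute)
  qed
  assume "of_int a * \<beta> (- 0) + of_int b * \<beta> (- 1) = 0"
  then show "a = 0 \<and> b = 0"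
    using independent[of b "-1" a] by (simp add: add.commute)
qed

section \<open>Coordinates of terms outside a cone\<close>

definition left_coords :: "int \<Rightarrow> int \<Rightarrow> int \<Rightarrow> int \<Rightarrow> bool" where
  "left_coords j k a b \<longleftrightarrow> \<beta> k = of_int a * \<beta> j - of_int b * \<beta> (j + 1) \<and> b \<ge> 1
     \<and> a - (v j - 1) * b \<ge> 1
     \<and> (k < j - 1 \<longrightarrow> b \<ge> 2 \<and> b \<ge> v (j - 1) \<and> a - (v j - 1) * b \<ge> v (j - 1) - 1)"

text \<open>
  The functional \<open>a - (v j - 1) * b\<close> takes the value \<open>1\<close> at \<open>\<beta> j\<close> and at \<open>\<beta> (j - 1)\<close>, and along a
  sequence with \<open>v \<ge> 2\<close> a functional is convex wherever it is nonnegative.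
\<close>

lemma left_coords_exist:
  assumes "k < j"
  shows "\<exists>a b. left_coords j k a b"
proof -
  let ?c = "\<lambda>k a b. \<beta> k = of_int a * \<beta> j - of_int b * \<beta> (j + 1)"
  let ?L = "\<lambda>a b. a - (v j - 1) * b"
  \<comment> \<open>The recurrence has order two, so the invariant speaks of two consecutive terms.
    The bounds by \<open>v (j - 1)\<close> are attained at \<open>j - 2\<close>; they later single
    out \<open>v (j - 1) = 2\<close>.\<close>
  let ?Q = "\<lambda>n a b a2 b2. ?c (j - 1 - int n) a b \<and> ?c (j - 2 - int n) a2 b2 \<and> 1 \<le> b \<and> b < b2
      \<and> v (j - 1) \<le> b2 \<and> 1 \<le> ?L a b \<and> ?L a b \<le> ?L a2 b2 \<and> v (j - 1) - 1 \<le> ?L a2 b2"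
  have *: "\<exists>a b a2 b2. ?Q n a b a2 b2" for n
  proof (induction n)
    case 0
    have c1: "?c (j - 1) (v j) 1" using beta_prev[of j] by simp
    have "\<beta> (j - 2) = of_int (v (j - 1)) * \<beta> (j - 1) - \<beta> j"
      using beta_prev[of "j - 1"] by simp
    then have "?c (j - 2) (v (j - 1) * v j - 1) (v (j - 1))"
      unfolding c1 by (simp add: algebra_simps)
    with c1 have "?Q 0 (v j) 1 (v (j - 1) * v j - 1) (v (j - 1))"
      using v_ge_2[of "j - 1"] by (simp add: algebra_simps)
    then show ?case by blast
  next
    case (Suc n)
    then obtain a b a2 b2 where h: "?c (j - 1 - int n) a b" "?c (j - 2 - int n) a2 b2"
      "1 \<le> b" "b < b2" "v (j - 1) \<le> b2" "1 \<le> ?L a b" "?L a b \<le> ?L a2 b2"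
      "v (j - 1) - 1 \<le> ?L a2 b2" by blast
    define w where "w = v (j - 2 - int n)"
    have w: "w \<ge> 2" unfolding w_def by (rule v_ge_2)
    have e: "j - 2 - int n - 1 = j - 2 - int (Suc n)" "j - 2 - int n + 1 = j - 1 - int n"
      "j - 1 - int (Suc n) = j - 2 - int n" by simp_all
    have "\<beta> (j - 2 - int (Suc n)) = of_int w * \<beta> (j - 2 - int n) - \<beta> (j - 1 - int n)"
      using beta_prev[of "j - 2 - int n"] unfolding e w_def .
    then have c: "?c (j - 2 - int (Suc n)) (w * a2 - a) (w * b2 - b)"
      unfolding h(1,2) by (simp add: algebra_simps)
    define x y where "x = ?L a b" and "y = ?L a2 b2"
    have xy: "1 \<le> x" "x \<le> y" "v (j - 1) - 1 \<le> y"
      using h(6-8) unfolding x_def y_def .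
    \<comment> \<open>Convexity: \<open>w \<ge> 2\<close> gives
      \<open>w * b2 - b \<ge> b2 + (b2 - b)\<close>, and likewise for the functional.\<close>
    have "2 * b2 \<le> w * b2" "2 * y \<le> w * y" using w h(3,4) xy by simp_all
    then have b3: "b2 < w * b2 - b" "v (j - 1) \<le> w * b2 - b" "y \<le> w * y - x" "v (j - 1) - 1 \<le> w * y - x"
      using h(3-5) xy by linarith+
    have L: "?L (w * a2 - a) (w * b2 - b) = w * y - x"
      by (simp add: x_def y_def algebra_simps)
    have "1 \<le> b2" "1 \<le> y" using h(3,4) xy by linarith+
    with h(2) c b3 have "?Q (Suc n) a2 b2 (w * a2 - a) (w * b2 - b)"
      unfolding e L y_def[symmetric] by (intro conjI)
    then show ?case by blast
  qed
  show ?thesis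
  proof (cases "k = j - 1")
    case True
    from *[of 0] obtain a b a2 b2 where "?Q 0 a b a2 b2" by blast
    then have "left_coords j k a b" using True unfolding left_coords_def by simp
    then show ?thesis by blast
  next
    case False
    define n where "n = nat (j - 2 - k)"
    have n: "j - 2 - int n = k" using assms False by (simp add: n_def)
    from *[of n] obtain a b a2 b2 where "?Q n a b a2 b2" by blast
    then have "left_coords j k a2 b2" unfolding left_coords_def n by (elim conjE) simp
    then show ?thesis by blast
  qed
qed

text \<open>\<open>a\<close> and \<open>b\<close> are totals over all summands left of the cone. The
  clauses after the two size bounds describe extremal totals; the exceptional cases of the count
  come from them.\<close>

definition left_sum :: "int \<Rightarrow> int multiset \<Rightarrow> int \<Rightarrow> int \<Rightarrow> bool" where
  "left_sum j N a b \<longleftrightarrow> (\<Sum>k\<in>#N. \<beta> k) = of_int a * \<beta> j - of_int b * \<beta> (j + 1)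
     \<and> int (size N) \<le> b \<and> int (size N) \<le> a - (v j - 1) * b
     \<and> (N = {#} \<longrightarrow> a = 0 \<and> b = 0)
     \<and> (b = 1 \<longrightarrow> N = {#j - 1#})
     \<and> (size N = 1 \<and> b \<ge> 2 \<and> (b = 2 \<or> a - (v j - 1) * b = 1) \<longrightarrow> v (j - 1) = 2)
     \<and> (size N = 1 \<and> b = 1 \<longrightarrow> a = v j)"

text \<open>Every summand contributes at least 1 to \<open>b\<close> and to
  \<open>a - (v j - 1) * b\<close>, so both totals bound the number of summands.\<close>

lemma left_sum_exists:
  assumes "\<forall>k\<in>#N. k < j"
  shows "\<exists>a b. left_sum j N a b"
proof -
  have "\<forall>k. \<exists>a b. k < j \<longrightarrow> left_coords j k a b"
    using left_coords_exist by blast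
  then obtain A B where "\<forall>k. k < j \<longrightarrow> left_coords j k (A k) (B k)"
    by metis
  then have AB: "left_coords j k (A k) (B k)" if "k < j" for k
    using that by blast
  have *: "(\<Sum>k\<in>#N. \<beta> k) = of_int (\<Sum>k\<in>#N. A k) * \<beta> j - of_int (\<Sum>k\<in>#N. B k) * \<beta> (j + 1)
      \<and> int (size N) \<le> (\<Sum>k\<in>#N. B k) \<and> int (size N) \<le> (\<Sum>k\<in>#N. A k) - (v j - 1) * (\<Sum>k\<in>#N. B k)"
    using assms
  proof (induction N)
    case empty
    then show ?case by simp
  next
    case (add k N)
    then have "left_coords j k (A k) (B k)" using AB by simp
    with add show ?case by (auto simp: left_coords_def algebra_simps)
  qed
  have one: "A (j - 1) = v j \<and> B (j - 1) = 1"
  proof -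
    have "of_int (A (j - 1)) * \<beta> j + of_int (- B (j - 1)) * \<beta> (j + 1)
        = of_int (v j) * \<beta> j + of_int (- 1) * \<beta> (j + 1)"
      using AB[of "j - 1"] beta_prev[of j] by (simp add: left_coords_def)
    from coords_unique[OF this] show ?thesis by simp
  qed
  have sing: "\<exists>k. N = {#k#} \<and> k < j" if "size N = 1"
    using that assms by (metis size_1_singleton_mset union_single_eq_member)
  have "N = {#j - 1#}" if "(\<Sum>k\<in>#N. B k) = 1"
  proof -
    have "N \<noteq> {#}" using that by auto
    then have "size N = 1" using * that by (simp add: nonempty_has_size)
    from sing[OF this] obtain k where "N = {#k#}" "k < j" by blast
    with AB[of k] that show ?thesis by (fastforce simp: left_coords_def)
  qed
  \<comment> \<open>A single term beyond \<open>j - 1\<close> has \<open>b \<ge> v (j - 1)\<close>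
    and functional at least \<open>v (j - 1) - 1\<close>, so either equality forces
    \<open>v (j - 1) \<le> 2\<close>.\<close>
  moreover have "v (j - 1) = 2" if "size N = 1" "(\<Sum>k\<in>#N. B k) \<ge> 2"
      "(\<Sum>k\<in>#N. B k) = 2 \<or> (\<Sum>k\<in>#N. A k) - (v j - 1) * (\<Sum>k\<in>#N. B k) = 1"
  proof -
    from sing[OF that(1)] obtain k where k: "N = {#k#}" "k < j" by blast
    then have "k \<noteq> j - 1" using that one by auto
    with k AB[of k] that v_ge_2[of "j - 1"] show ?thesis by (auto simp: left_coords_def)
  qed
  ultimately show ?thesis
    using * one unfolding left_sum_def
    by (intro exI[of _ "\<Sum>k\<in>#N. A k"] exI[of _ "\<Sum>k\<in>#N. B k"]) auto
qed

definition right_sum :: "int \<Rightarrow> int multiset \<Rightarrow> int \<Rightarrow> int \<Rightarrow> bool" where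
  "right_sum j N c d \<longleftrightarrow> (\<Sum>k\<in>#N. \<beta> k) = of_int c * \<beta> (j + 1) - of_int d * \<beta> j
     \<and> int (size N) \<le> d \<and> int (size N) \<le> c - (v (j + 1) - 1) * d
     \<and> (N = {#} \<longrightarrow> c = 0 \<and> d = 0)
     \<and> (d = 1 \<longrightarrow> N = {#j + 2#})
     \<and> (size N = 1 \<and> d \<ge> 2 \<and> (d = 2 \<or> c - (v (j + 1) - 1) * d = 1) \<longrightarrow> v (j + 2) = 2)
     \<and> (size N = 1 \<and> d = 1 \<longrightarrow> c = v (j + 1))"

lemma right_sum_exists:
  assumes "\<forall>k\<in>#N. k > j + 1"
  shows "\<exists>c d. right_sum j N c d"
proof -
  interpret m: beta_chain "\<lambda>k. \<beta> (- k)" "\<lambda>k. v (- k)" by (rule mirror)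
  have "\<forall>k\<in>#image_mset uminus N. k < - (j + 1)" using assms by auto
  from m.left_sum_exists[OF this] obtain c d where
    cd: "m.left_sum (- (j + 1)) (image_mset uminus N) c d" by blast
  have e: "- (- (j + 1)) = j + 1" "- (- (j + 1) + 1) = j" "- (- (j + 1) - 1) = j + 2" by simp_all
  have sum_eq: "(\<Sum>k\<in>#image_mset uminus N. \<beta> (- k)) = (\<Sum>k\<in>#N. \<beta> k)"
    by (simp add: multiset.map_comp comp_def)
  have sing: "image_mset uminus N = {#- (j + 1) - 1#} \<longleftrightarrow> N = {#j + 2#}"
  proof
    assume "image_mset uminus N = {#- (j + 1) - 1#}"
    then have "image_mset uminus (image_mset uminus N) = {#j + 2#}" by simp
    then show "N = {#j + 2#}" by (simp add: multiset.map_comp comp_def)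
  qed simp
  from cd have "right_sum j N c d"
    unfolding right_sum_def m.left_sum_def e sum_eq sing size_image_mset image_mset_is_empty_iff .
  then show ?thesis by blast
qed

lemma left_sum_bounds:
  "left_sum j N a b \<Longrightarrow> int (size N) \<le> b \<and> int (size N) \<le> a - (v j - 1) * b"
  unfolding left_sum_def by blast

lemma right_sum_bounds:
  "right_sum j N c d \<Longrightarrow> int (size N) \<le> d \<and> int (size N) \<le> c - (v (j + 1) - 1) * d"
  unfolding right_sum_def by blast

text \<open>The summands are sorted into a left part, a right part and copies of the two generators.
  The left part costs \<open>b\<close> in the second coordinate, the right part \<open>d\<close> in
  the first.\<close>

lemma decomposition:
  assumes "(\<Sum>k\<in>#N. \<beta> k) = of_int e * \<beta> j + of_int f * \<beta> (j + 1)"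
  obtains NL NR a b c d m0 m1 where
    "N = NL + NR + replicate_mset m0 j + replicate_mset m1 (j + 1)"
    "left_sum j NL a b" "right_sum j NR c d"
    "e = int m0 + a - d" "f = int m1 + c - b"
proof -
  define NL NR where "NL = filter_mset (\<lambda>k. k < j) N" and "NR = filter_mset (\<lambda>k. k > j + 1) N"
  have N: "N = NL + NR + replicate_mset (count N j) j + replicate_mset (count N (j + 1)) (j + 1)"
    by (rule multiset_eqI) (auto simp: NL_def NR_def)
  obtain a b where ab: "left_sum j NL a b" using left_sum_exists[of NL j] by (auto simp: NL_def)
  obtain c d where cd: "right_sum j NR c d" using right_sum_exists[of NR j] by (auto simp: NR_def)
  have "(\<Sum>k\<in>#N. \<beta> k) = (\<Sum>k\<in>#NL. \<beta> k) + (\<Sum>k\<in>#NR. \<beta> k)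
      + of_int (int (count N j)) * \<beta> j + of_int (int (count N (j + 1))) * \<beta> (j + 1)"
    by (subst N) simp
  with assms ab cd have
    "of_int e * \<beta> j + of_int f * \<beta> (j + 1)
      = of_int (int (count N j) + a - d) * \<beta> j + of_int (int (count N (j + 1)) + c - b) * \<beta> (j + 1)"
    by (simp add: left_sum_def right_sum_def algebra_simps)
  then show thesis using coords_unique by (intro that[OF N ab cd]) blast+
qed

section \<open>Classification of representations in the critical ranges\<close>

definition trivial_rep :: "int \<Rightarrow> int \<Rightarrow> int \<Rightarrow> int multiset" where
  "trivial_rep j e f = replicate_mset (nat e) j + replicate_mset (nat f) (j + 1)"

text \<open>Summands on one side only would push the coordinate of that side up to \<open>v\<close>.
  With summands on both sides, \<open>b\<close> and \<open>d\<close> cancel in \<open>e + f\<close>,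
  and its upper bound turns every estimate into an equality: one summand on each side, no
  generators.\<close>

lemma small_coords:
  assumes sum: "(\<Sum>k\<in>#N. \<beta> k) = of_int e * \<beta> j + of_int f * \<beta> (j + 1)"
    and e: "e \<le> v j - 1" and f: "f \<le> v (j + 1) - 1"
  shows "N = trivial_rep j e f \<or> e = v j - 1 \<and> f = v (j + 1) - 1
    \<and> (N = {#j - 1, j + 2#} \<or> v (j - 1) = 2 \<and> v j = 2 \<and> v (j + 1) = 2 \<and> v (j + 2) = 2)"
proof -
  obtain NL NR a b c d m0 m1 where
    N: "N = NL + NR + replicate_mset m0 j + replicate_mset m1 (j + 1)"
    and L: "left_sum j NL a b" and R: "right_sum j NR c d"
    and ef: "e = int m0 + a - d" "f = int m1 + c - b"
    by (rule decomposition[OF sum])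
  have v: "v j \<ge> 2" "v (j + 1) \<ge> 2" using v_ge_2 by auto
  \<comment> \<open>The products are expanded around \<open>b = 1\<close> and \<open>d = 1\<close>;
    the remainders are nonnegative on a nonempty side, and everything else is linear.\<close>
  define p q where "p = (v j - 2) * (b - 1)" and "q = (v (j + 1) - 2) * (d - 1)"
  have pq: "(v j - 1) * b = p + b + v j - 2" "(v (j + 1) - 1) * d = q + d + v (j + 1) - 2"
    unfolding p_def q_def by (simp_all add: algebra_simps)
  have Lb: "int (size NL) \<le> b" "int (size NL) \<le> a - (p + b + v j - 2)"
    and Rb: "int (size NR) \<le> d" "int (size NR) \<le> c - (q + d + v (j + 1) - 2)"
    using left_sum_bounds[OF L] right_sum_bounds[OF R] unfolding pq by blast+
  have p0: "p \<ge> 0" if "NL \<noteq> {#}"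
  proof -
    have "b \<ge> 1" using that Lb(1) by (simp add: size_eq_0_iff_empty[symmetric] del: size_eq_0_iff_empty)
    then show ?thesis using v by (simp add: p_def)
  qed
  have q0: "q \<ge> 0" if "NR \<noteq> {#}"
  proof -
    have "d \<ge> 1" using that Rb(1) by (simp add: size_eq_0_iff_empty[symmetric] del: size_eq_0_iff_empty)
    then show ?thesis using v by (simp add: q_def)
  qed
  have sL: "int (size NL) \<ge> 1 \<longleftrightarrow> NL \<noteq> {#}" and sR: "int (size NR) \<ge> 1 \<longleftrightarrow> NR \<noteq> {#}"
    by (auto simp: Suc_le_eq nonempty_has_size)
  have L0: "a = 0 \<and> b = 0" if "NL = {#}" using L that by (simp add: left_sum_def)
  have R0: "c = 0 \<and> d = 0" if "NR = {#}" using R that by (simp add: right_sum_def)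
  show ?thesis
  proof (cases "NL = {#} \<or> NR = {#}")
    case True
    have "NL = {#} \<and> NR = {#}"
    proof (rule ccontr)
      assume "\<not> ?thesis"
      with True consider "NL = {#}" "NR \<noteq> {#}" | "NL \<noteq> {#}" "NR = {#}" by blast
      then show False
      proof cases
        case 1
        with L0 q0 sR Rb ef f show False by auto
      next
        case 2
        with R0 p0 sL Lb ef e show False by auto
      qed
    qed
    with L0 R0 ef N show ?thesis by (simp add: trivial_rep_def)
  next
    case False
    then have h: "p \<ge> 0" "q \<ge> 0" "int (size NL) \<ge> 1" "int (size NR) \<ge> 1"
      using p0 q0 sL sR by auto
    have eq: "int (size NL) = 1" "int (size NR) = 1" "m0 = 0" "m1 = 0" "b = d" "p = 0" "q = 0"
      "a = p + b + v j - 1" "c = q + d + v (j + 1) - 1" "e = v j - 1" "f = v (j + 1) - 1"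
      using h Lb Rb ef e f by linarith+
    show ?thesis
    proof (cases "b = 1")
      case True
      with L R eq have "NL = {#j - 1#}" "NR = {#j + 2#}"
        by (simp_all add: left_sum_def right_sum_def)
      with N eq show ?thesis by (simp add: add.commute)
    next
      case False
      \<comment> \<open>Vanishing \<open>p\<close> and \<open>q\<close> now force
        \<open>v j = v (j + 1) = 2\<close>. The single summand on each side lies beyond the nearest
        neighbour with functional 1, which forces the outer coefficients.\<close>
      then have b2: "b \<ge> 2" "d \<ge> 2" using h Lb eq by linarith+
      with eq(5-7) have "v j = 2" "v (j + 1) = 2" by (auto simp: p_def q_def)
      moreover have "a - (v j - 1) * b = 1" "c - (v (j + 1) - 1) * d = 1" using eq pq by linarith+
      ultimately show ?thesis using L R b2 eq by (simp add: left_sum_def right_sum_def)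
    qed
  qed
qed

text \<open>For \<open>e \<ge> v j\<close>: the exchange
  \<open>v j * \<beta> j = \<beta> (j - 1) + \<beta> (j + 1)\<close> applied once to
  \<open>trivial_rep j e f\<close>.\<close>

definition left_rep :: "int \<Rightarrow> int \<Rightarrow> int \<Rightarrow> int multiset" where
  "left_rep j e f = add_mset (j - 1) (trivial_rep j (e - v j) (f + 1))"

text \<open>The left total \<open>b\<close> decides: 0 gives the trivial representation, 1 the
  exchanged one, and \<open>b \<ge> 2\<close> leads to the boundary pairs removed by
  \<open>exc\<close>.\<close>

lemma large_left_coord:
  assumes sum: "(\<Sum>k\<in>#N. \<beta> k) = of_int e * \<beta> j + of_int f * \<beta> (j + 1)"
    and e: "e \<le> 2 * v j - 1" and f: "f \<le> v (j + 1) - 2"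
    and exc: "(e, f) \<noteq> (2 * v j - 1, v (j + 1) - 2)" "(v (j - 1), e) \<noteq> (2, 2 * v j - 1)"
      "(v (j - 1), e, f) \<noteq> (2, 2 * v j - 2, v (j + 1) - 2)"
  shows "N = trivial_rep j e f \<or> N = left_rep j e f"
proof -
  obtain NL NR a b c d m0 m1 where
    N: "N = NL + NR + replicate_mset m0 j + replicate_mset m1 (j + 1)"
    and L: "left_sum j NL a b" and R: "right_sum j NR c d"
    and ef: "e = int m0 + a - d" "f = int m1 + c - b"
    by (rule decomposition[OF sum])
  have v: "v j \<ge> 2" "v (j + 1) \<ge> 2" using v_ge_2 by auto
  \<comment> \<open>The first product is expanded around \<open>b = 2\<close>, the smallest value in
    the case to be refuted.\<close>
  define p q where "p = (v j - 2) * (b - 2)" and "q = (v (j + 1) - 2) * (d - 1)"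
  have pq: "(v j - 1) * b = p + b + 2 * v j - 4" "(v (j + 1) - 1) * d = q + d + v (j + 1) - 2"
    unfolding p_def q_def by (simp_all add: algebra_simps)
  have Lb: "int (size NL) \<le> b" "int (size NL) \<le> a - (p + b + 2 * v j - 4)"
    and Rb: "int (size NR) \<le> d" "int (size NR) \<le> c - (q + d + v (j + 1) - 2)"
    using left_sum_bounds[OF L] right_sum_bounds[OF R] unfolding pq by blast+
  have sL: "int (size NL) \<ge> 1 \<longleftrightarrow> NL \<noteq> {#}" and sR: "int (size NR) \<ge> 1 \<longleftrightarrow> NR \<noteq> {#}"
    by (auto simp: Suc_le_eq nonempty_has_size)
  have q0: "q \<ge> 0" if "NR \<noteq> {#}"
  proof -
    have "d \<ge> 1" using that Rb(1) sR by linarith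
    then show ?thesis using v by (simp add: q_def)
  qed
  have L0: "a = 0 \<and> b = 0" if "NL = {#}" using L that by (simp add: left_sum_def)
  have R0: "c = 0 \<and> d = 0" if "NR = {#}" using R that by (simp add: right_sum_def)
  have b0: "b \<ge> 0" using Lb(1) by linarith
  then consider "b = 0" | "b = 1" | "b \<ge> 2" by linarith
  then show ?thesis
  proof cases
    case 1
    then have "NL = {#}" using Lb by simp
    moreover have "NR = {#}"
    proof (rule ccontr)
      assume "NR \<noteq> {#}"
      with q0 sR Rb ef f 1 show False by auto
    qed
    ultimately show ?thesis using L0 R0 ef N by (simp add: trivial_rep_def)
  next
    case 2
    then have NL: "NL = {#j - 1#}" using L by (simp add: left_sum_def)
    then have "a = v j" using L 2 by (simp add: left_sum_def)
    \<comment> \<open>A summand on the right would force \<open>f \<ge> v (j + 1) - b\<close>, here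
      \<open>v (j + 1) - 1\<close>.\<close>
    have "NR = {#}"
    proof (rule ccontr)
      assume "NR \<noteq> {#}"
      with q0 sR Rb ef f 2 show False by auto
    qed
    with R0 ef N NL \<open>a = v j\<close> 2 show ?thesis by (simp add: left_rep_def trivial_rep_def)
  next
    case 3
    then have p: "p \<ge> 0" using v by (simp add: p_def)
    have "NL \<noteq> {#}" using L0 3 by auto
    then have l: "int (size NL) \<ge> 1" using sL by simp
    have False
    proof (cases "NR = {#}")
      case True
      then have "d = 0" using R0 by simp
      with l p Lb ef e 3 have "size NL = 1" "b = 2" "e = 2 * v j - 1" by linarith+
      with L exc(2) show False by (simp add: left_sum_def)
    next
      case False
      then have r: "int (size NR) \<ge> 1" "q \<ge> 0" using q0 sR by auto
      have ne: "e = 2 * v j - 1 \<Longrightarrow> f \<noteq> v (j + 1) - 2" using exc(1) by auto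
      \<comment> \<open>The bounds of both sides add up to one less than the largest possible sum.
        The pair attaining the largest sum is excluded, so equality holds throughout.\<close>
      have "e + f \<ge> 2 * v j + v (j + 1) - 4" using l p r ef Lb Rb by linarith
      then have "e = 2 * v j - 1 \<and> f = v (j + 1) - 3 \<or> e = 2 * v j - 2 \<and> f = v (j + 1) - 2"
        using e f ne by linarith
      moreover from this have "int (size NL) = 1" "a - (p + b + 2 * v j - 4) = 1"
        using l p r ef Lb Rb by linarith+
      then have "v (j - 1) = 2" using L 3 unfolding left_sum_def pq by simp
      ultimately show False using exc by auto
    qed
    then show ?thesis ..
  qed
qed


section \<open>Counting by regions of the pair \<open>(e, f)\<close>\<close>

definition reps :: "int \<Rightarrow> int \<Rightarrow> int \<Rightarrow> int multiset set" where
  "reps j e f = {N. (\<Sum>k\<in>#N. \<beta> k) = of_int e * \<beta> j + of_int f * \<beta> (j + 1)}"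

lemma sum_trivial_rep:
  "e \<ge> 0 \<Longrightarrow> f \<ge> 0 \<Longrightarrow> (\<Sum>k\<in>#trivial_rep j e f. \<beta> k) = of_int e * \<beta> j + of_int f * \<beta> (j + 1)"
  by (simp add: trivial_rep_def)

lemma trivial_rep_in_reps: "e \<ge> 0 \<Longrightarrow> f \<ge> 0 \<Longrightarrow> trivial_rep j e f \<in> reps j e f"
  by (simp add: reps_def sum_trivial_rep)

lemma left_rep_in_reps: "e \<ge> v j \<Longrightarrow> f \<ge> 0 \<Longrightarrow> left_rep j e f \<in> reps j e f"
  by (simp add: reps_def left_rep_def sum_trivial_rep beta_prev algebra_simps)

lemma count_trivial_rep:
  "k \<noteq> j \<Longrightarrow> k \<noteq> j + 1 \<Longrightarrow> count (trivial_rep j e f) k = 0"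
  by (simp add: trivial_rep_def)

lemma count_left_rep:
  "count (left_rep j e f) (j - 1) = 1" "count (left_rep j e f) (j - 2) = 0"
  "count (left_rep j e f) (j + 2) = 0"
  by (simp_all add: left_rep_def count_trivial_rep)

lemma both_sides_in_reps:
  assumes "e \<ge> v j - 1" "f \<ge> v (j + 1) - 1"
  shows "{#j - 1, j + 2#} + trivial_rep j (e - v j + 1) (f - v (j + 1) + 1) \<in> reps j e f"
  using assms by (simp add: reps_def sum_trivial_rep beta_prev beta_next algebra_simps)

lemma beta_prev2: "\<beta> (j - 2) = of_int (v (j - 1) * v j - 1) * \<beta> j - of_int (v (j - 1)) * \<beta> (j + 1)"
proof -
  have "\<beta> (j - 2) = of_int (v (j - 1)) * \<beta> (j - 1) - \<beta> j"
    using beta_prev[of "j - 1"] by simp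
  then show ?thesis unfolding beta_prev[of j] by (simp add: algebra_simps)
qed

lemma beta_next2:
  "\<beta> (j + 3) = of_int (v (j + 2) * v (j + 1) - 1) * \<beta> (j + 1) - of_int (v (j + 2)) * \<beta> j"
proof -
  have "j + 1 + 2 = j + 3" "j + 1 + 1 = j + 2" by simp_all
  then have "\<beta> (j + 3) = of_int (v (j + 2)) * \<beta> (j + 2) - \<beta> (j + 1)"
    using beta_next[of "j + 1"] by metis
  then show ?thesis unfolding beta_next[of j] by (simp add: algebra_simps)
qed

text \<open>The trivial representation and its exchange exist throughout this range. Each failure of
  the right-hand side produces a third one, recognisable by using \<open>j - 1\<close> twice or
  \<open>j - 2\<close> once.\<close>

lemma card_reps_left:
  assumes "v j \<le> e" "0 \<le> f" "f \<le> v (j + 1) - 2"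
  shows "card (reps j e f) = 2 \<longleftrightarrow> e \<le> 2 * v j - 1
    \<and> (e, f) \<noteq> (2 * v j - 1, v (j + 1) - 2) \<and> (v (j - 1), e) \<noteq> (2, 2 * v j - 1)
    \<and> (v (j - 1), e, f) \<noteq> (2, 2 * v j - 2, v (j + 1) - 2)" (is "_ \<longleftrightarrow> ?R")
proof
  have v2: "v j \<ge> 2" "v (j + 1) \<ge> 2" using v_ge_2 by auto
  have T: "trivial_rep j e f \<in> reps j e f" using assms v2 by (intro trivial_rep_in_reps) auto
  have L: "left_rep j e f \<in> reps j e f" using assms by (intro left_rep_in_reps) auto
  have TL: "trivial_rep j e f \<noteq> left_rep j e f"
    using count_left_rep(1)[of j e f] count_trivial_rep[of "j - 1" j e f] by auto
  {
    assume ?R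
    have "reps j e f \<subseteq> {trivial_rep j e f, left_rep j e f}"
      using large_left_coord[of _ e j f] assms \<open>?R\<close> unfolding reps_def by blast
    then have "reps j e f = {trivial_rep j e f, left_rep j e f}" using T L by blast
    then show "card (reps j e f) = 2" using TL by simp
  next
    assume two: "card (reps j e f) = 2"
    have no: False if "N \<in> reps j e f" "count N (j - 1) = 2 \<or> count N (j - 2) = 1" for N
    proof -
      have "N \<noteq> trivial_rep j e f" "N \<noteq> left_rep j e f"
        using that(2) count_left_rep[of j e f] count_trivial_rep[of "j - 1" j e f]
          count_trivial_rep[of "j - 2" j e f] by auto
      with card_ne_2[OF T L that(1) TL] two show False by auto
    qed
    show ?R
    proof (rule ccontr)
      assume "\<not> ?R"
      then consider "e \<ge> 2 * v j" | "e = 2 * v j - 1" "f = v (j + 1) - 2"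
        | "v (j - 1) = 2" "e = 2 * v j - 1" | "v (j - 1) = 2" "e = 2 * v j - 2" "f = v (j + 1) - 2"
        by force
      then show False
      proof cases
        case 1
        \<comment> \<open>The exchange applied twice.\<close>
        show False
        proof (rule no)
          show "{#j - 1, j - 1#} + trivial_rep j (e - 2 * v j) (f + 2) \<in> reps j e f"
            using 1 assms by (simp add: reps_def sum_trivial_rep beta_prev algebra_simps)
        qed (simp add: count_trivial_rep)
      next
        case 2
        \<comment> \<open>\<open>2 * \<beta> (j - 1) + \<beta> (j + 2)\<close> has exactly these
          coordinates.\<close>
        show False
        proof (rule no)
          show "{#j - 1, j - 1, j + 2#} \<in> reps j e f"
            unfolding reps_def 2 by (simp add: beta_prev beta_next algebra_simps)
        qed simp
      next
        case 3
        \<comment> \<open>For \<open>v (j - 1) = 2\<close> the term \<open>\<beta> (j - 2)\<close>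
          equals \<open>(2 * v j - 1) * \<beta> j - 2 * \<beta> (j + 1)\<close>.\<close>
        show False
        proof (rule no)
          show "add_mset (j - 2) (trivial_rep j 0 (f + 2)) \<in> reps j e f"
            unfolding reps_def 3(2) using 3(1) assms
            by (simp add: sum_trivial_rep beta_prev2 algebra_simps)
        qed (simp add: count_trivial_rep)
      next
        case 4
        \<comment> \<open>The same value of \<open>\<beta> (j - 2)\<close>, with
          \<open>\<beta> (j + 2) = v (j + 1) * \<beta> (j + 1) - \<beta> j\<close> added.\<close>
        show False
        proof (rule no)
          show "{#j - 2, j + 2#} \<in> reps j e f"
            unfolding reps_def 4 by (simp add: beta_prev2 beta_next 4(1) algebra_simps)
        qed simp
      qed
    qed
  }
qed

text \<open>A third representation comes from \<open>\<beta> (j - 1) + \<beta> (j + 2) = (v j - 1) *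
  \<beta> j + (v (j + 1) - 1) * \<beta> (j + 1)\<close>.\<close>

lemma card_reps_both_sides:
  assumes "v j \<le> e" "v (j + 1) - 1 \<le> f"
  shows "card (reps j e f) \<noteq> 2"
proof -
  have v2: "v j \<ge> 2" "v (j + 1) \<ge> 2" using v_ge_2 by auto
  let ?B = "{#j - 1, j + 2#} + trivial_rep j (e - v j + 1) (f - v (j + 1) + 1)"
  have c: "count ?B (j + 2) = 1" by (simp add: count_trivial_rep)
  show ?thesis
  proof (rule card_ne_2)
    show "trivial_rep j e f \<in> reps j e f" using assms v2 by (intro trivial_rep_in_reps) auto
    show "left_rep j e f \<in> reps j e f" using assms v2 by (intro left_rep_in_reps) auto
    show "?B \<in> reps j e f" using assms by (intro both_sides_in_reps) auto
    show "trivial_rep j e f \<noteq> left_rep j e f"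
      using count_left_rep(1)[of j e f] count_trivial_rep[of "j - 1" j e f] by auto
    show "trivial_rep j e f \<noteq> ?B" using c count_trivial_rep[of "j + 2" j e f] by auto
    show "left_rep j e f \<noteq> ?B" using c count_left_rep(3)[of j e f] by auto
  qed
qed

text \<open>If all four coefficients are 2, the terms from \<open>j - 2\<close> to
  \<open>j + 3\<close> form an arithmetic progression, so
  \<open>\<beta> (j - 2) + \<beta> (j + 3)\<close> joins the two representations that always
  exist.\<close>

lemma card_reps_middle:
  "card (reps j (v j - 1) (v (j + 1) - 1)) = 2
    \<longleftrightarrow> (v (j - 1), v j, v (j + 1), v (j + 2)) \<noteq> (2, 2, 2, 2)" (is "card ?S = 2 \<longleftrightarrow> ?R")
proof
  let ?T = "trivial_rep j (v j - 1) (v (j + 1) - 1)"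
  have v2: "v j \<ge> 2" "v (j + 1) \<ge> 2" using v_ge_2 by auto
  have T: "?T \<in> ?S" using v2 by (intro trivial_rep_in_reps) auto
  have "{#j - 1, j + 2#} + trivial_rep j 0 0 \<in> ?S"
    using both_sides_in_reps[of j "v j - 1" "v (j + 1) - 1"] by simp
  then have B: "{#j - 1, j + 2#} \<in> ?S" by (simp add: trivial_rep_def)
  have TB: "?T \<noteq> {#j - 1, j + 2#}"
  proof
    assume "?T = {#j - 1, j + 2#}"
    then have "count ?T (j + 2) = 1" by simp
    then show False by (simp add: count_trivial_rep)
  qed
  {
    assume ?R
    then have "?S \<subseteq> {?T, {#j - 1, j + 2#}}"
      using small_coords[of _ "v j - 1" j "v (j + 1) - 1"] unfolding reps_def by blast
    then have "?S = {?T, {#j - 1, j + 2#}}" using T B by blast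
    then show "card ?S = 2" using TB by simp
  next
    assume two: "card ?S = 2"
    show ?R
    proof
      assume "(v (j - 1), v j, v (j + 1), v (j + 2)) = (2, 2, 2, 2)"
      then have C: "{#j - 2, j + 3#} \<in> ?S"
        by (simp add: reps_def beta_prev2 beta_next2 algebra_simps)
      have "?T \<noteq> {#j - 2, j + 3#}"
      proof
        assume "?T = {#j - 2, j + 3#}"
        then have "count ?T (j + 3) = 1" by simp
        then show False by (simp add: count_trivial_rep)
      qed
      moreover have "{#j - 1, j + 2#} \<noteq> {#j - 2, j + 3#}"
        by (auto simp: add_eq_conv_ex)
      ultimately show False using card_ne_2[OF T B C TB] two by blast
    qed
  }
qed

lemma card_reps_small:
  assumes "0 \<le> e" "e \<le> v j - 1" "0 \<le> f" "f \<le> v (j + 1) - 1" "e \<noteq> v j - 1 \<or> f \<noteq> v (j + 1) - 1"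
  shows "card (reps j e f) \<noteq> 2"
proof -
  have "reps j e f \<subseteq> {trivial_rep j e f}"
    using small_coords[of _ e j f] assms unfolding reps_def by blast
  then have "card (reps j e f) \<le> 1" using card_mono[of "{trivial_rep j e f}"] by fastforce
  then show ?thesis by simp
qed

text \<open>Transfers counts to the other side. The arguments swap because the reflected cone starts
  with \<open>\<beta> (j + 1)\<close>.\<close>

lemma card_reps_mirror:
  "card (beta_chain.reps (\<lambda>k. \<beta> (- k)) (- (j + 1)) f e) = card (reps j e f)"
proof -
  interpret m: beta_chain "\<lambda>k. \<beta> (- k)" "\<lambda>k. v (- k)" by (rule mirror)
  have inv: "image_mset uminus (image_mset uminus N) = N" for N :: "int multiset"
    by (simp add: multiset.map_comp comp_def)
  have s: "(\<Sum>k\<in>#image_mset uminus N. \<beta> (- k)) = (\<Sum>k\<in>#N. \<beta> k)" for N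
    by (simp add: multiset.map_comp comp_def)
  have e: "- (- (j + 1)) = j + 1" "- (- (j + 1) + 1) = j" by simp_all
  have iff: "image_mset uminus N \<in> m.reps (- (j + 1)) f e \<longleftrightarrow> N \<in> reps j e f" for N
    unfolding m.reps_def reps_def mem_Collect_eq s e by (simp add: add.commute)
  have "m.reps (- (j + 1)) f e = image_mset uminus ` reps j e f"
  proof (intro equalityI subsetI)
    fix N assume "N \<in> m.reps (- (j + 1)) f e"
    then have "image_mset uminus N \<in> reps j e f" using iff[of "image_mset uminus N"] by (simp only: inv)
    then show "N \<in> image_mset uminus ` reps j e f" by (metis imageI inv)
  next
    fix N assume "N \<in> image_mset uminus ` reps j e f"
    then show "N \<in> m.reps (- (j + 1)) f e" using iff by blast
  qed
  moreover have "inj_on (image_mset uminus) (reps j e f)" by (rule inj_onI) (metis inv)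
  ultimately show ?thesis by (simp add: card_image)
qed

theorem card_reps_eq_2_iff:
  assumes "e \<ge> 1" "f \<ge> 0"
  shows "card (reps j e f) = 2 \<longleftrightarrow>
     (v j \<le> e \<and> e \<le> 2 * v j - 1 \<and> 0 \<le> f \<and> f \<le> v (j + 1) - 2
        \<and> (e, f) \<noteq> (2 * v j - 1, v (j + 1) - 2)
        \<and> (v (j - 1), e) \<noteq> (2, 2 * v j - 1)
        \<and> (v (j - 1), e, f) \<noteq> (2, 2 * v j - 2, v (j + 1) - 2))
   \<or> (1 \<le> e \<and> e \<le> v j - 2 \<and> v (j + 1) \<le> f \<and> f \<le> 2 * v (j + 1) - 1
        \<and> (e, f) \<noteq> (v j - 2, 2 * v (j + 1) - 1)
        \<and> (f, v (j + 2)) \<noteq> (2 * v (j + 1) - 1, 2)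
        \<and> (e, f, v (j + 2)) \<noteq> (v j - 2, 2 * v (j + 1) - 2, 2))
   \<or> (e = v j - 1 \<and> f = v (j + 1) - 1
        \<and> (v (j - 1), v j, v (j + 1), v (j + 2)) \<noteq> (2, 2, 2, 2))"
proof -
  interpret m: beta_chain "\<lambda>k. \<beta> (- k)" "\<lambda>k. v (- k)" by (rule mirror)
  have r: "- (- (j + 1)) = j + 1" "- (- (j + 1) + 1) = j" "- (- (j + 1) - 1) = j + 2" by simp_all
  \<comment> \<open>The pairs are divided along \<open>e = v j - 1\<close> and
    \<open>f = v (j + 1) - 1\<close>. The third case is the corner, the fourth and fifth mirror the
    second and first, and the last admits only the trivial representation.\<close>
  consider "v j \<le> e" "f \<le> v (j + 1) - 2" | "v j \<le> e" "v (j + 1) - 1 \<le> f"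
    | "e = v j - 1" "f = v (j + 1) - 1" | "e \<le> v j - 1" "v (j + 1) \<le> f" "e = v j - 1"
    | "e \<le> v j - 2" "v (j + 1) \<le> f"
    | "e \<le> v j - 1" "f \<le> v (j + 1) - 1" "e \<noteq> v j - 1 \<or> f \<noteq> v (j + 1) - 1"
    by linarith
  then show ?thesis
  proof cases
    case 1
    with card_reps_left[of j e f] assms show ?thesis by auto
  next
    case 2
    with card_reps_both_sides[of j e f] show ?thesis by auto
  next
    case 3
    with card_reps_middle[of j] show ?thesis by auto
  next
    case 4
    then have "card (reps j e f) \<noteq> 2"
      using m.card_reps_both_sides[of "- (j + 1)" f e] unfolding card_reps_mirror r by simp
    with 4 show ?thesis by auto
  next
    case 5
    then have "card (reps j e f) = 2 \<longleftrightarrow> f \<le> 2 * v (j + 1) - 1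
        \<and> (f, e) \<noteq> (2 * v (j + 1) - 1, v j - 2) \<and> (v (j + 2), f) \<noteq> (2, 2 * v (j + 1) - 1)
        \<and> (v (j + 2), f, e) \<noteq> (2, 2 * v (j + 1) - 2, v j - 2)"
      using m.card_reps_left[of "- (j + 1)" f e] assms unfolding card_reps_mirror r by simp
    with 5 assms show ?thesis by auto
  next
    case 6
    with card_reps_small[of e j f] assms show ?thesis by auto
  qed
qed

section \<open>From index multisets to partitions into indecomposables\<close>

lemma inj_beta: "inj \<beta>"
proof (rule linorder_injI)
  fix k l :: int assume "k < l"
  show "\<beta> k \<noteq> \<beta> l"
  proof
    assume eq: "\<beta> k = \<beta> l"
    show False
    proof (cases "l = k + 1")
      case True
      with eq independent[of 1 k "-1"] show False by simp
    next
      case False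
      \<comment> \<open>As a singleton right of the cone at \<open>k\<close>,
        \<open>\<beta> l\<close> has a negative coordinate along \<open>\<beta> k\<close>.\<close>
      with \<open>k < l\<close> have "\<forall>i\<in>#{#l#}. i > k + 1" by simp
      from right_sum_exists[OF this] obtain c d where "right_sum k {#l#} c d" by blast
      then have "\<beta> l = of_int c * \<beta> (k + 1) - of_int d * \<beta> k" "1 \<le> d"
        by (simp_all add: right_sum_def)
      with eq independent[of "d + 1" k "- c"] show False by (simp add: algebra_simps)
    qed
  qed
qed

lemma num_partitions_range:
  assumes "e \<ge> 1"
  shows "num_partitions (range \<beta>) (of_int e * \<beta> j + of_int f * \<beta> (j + 1)) = card (reps j e f)"
proof -
  let ?x = "of_int e * \<beta> j + of_int f * \<beta> (j + 1)"
  let ?S = "{M. M \<noteq> {#} \<and> set_mset M \<subseteq> range \<beta> \<and> sum_mset M = ?x}"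
  \<comment> \<open>A nonzero total keeps the empty multiset out of \<open>reps j e f\<close>,
    matching \<open>M \<noteq> {#}\<close>.\<close>
  have x: "?x \<noteq> 0" using independent[of e j f] assms by auto
  have "?S = image_mset \<beta> ` reps j e f"
  proof (intro equalityI subsetI)
    fix M assume M: "M \<in> ?S"
    have "image_mset \<beta> (image_mset (inv \<beta>) M) = image_mset (\<lambda>x. x) M"
      unfolding multiset.map_comp comp_def using M by (intro image_mset_cong) (auto simp: f_inv_into_f)
    then have "M = image_mset \<beta> (image_mset (inv \<beta>) M)" by simp
    with M show "M \<in> image_mset \<beta> ` reps j e f" unfolding reps_def by (metis (mono_tags, lifting) image_eqI mem_Collect_eq)
  next
    fix M assume "M \<in> image_mset \<beta> ` reps j e f"
    with x show "M \<in> ?S" by (auto simp: reps_def)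
  qed
  moreover have "inj_on (image_mset \<beta>) (reps j e f)"
    using inj_beta by (meson inj_on_subset multiset.inj_map subset_UNIV)
  ultimately show ?thesis by (simp add: num_partitions_def card_image)
qed

text \<open>If \<open>e + f \<ge> 2\<close>, a generator splits off. Conversely,
  \<open>\<beta> j = y + z\<close> would combine representations of \<open>y\<close> and
  \<open>z\<close> into one of \<open>\<beta> j\<close> with at least two terms, against uniqueness
  at the coordinates \<open>(1, 0)\<close>.\<close>

lemma indecomposables_eq_range:
  assumes S: "\<And>x. x \<in> S \<longleftrightarrow> (\<exists>j e f. e \<ge> 1 \<and> f \<ge> 0 \<and> x = of_int e * \<beta> j + of_int f * \<beta> (j + 1))"
  shows "{x \<in> S. \<not> (\<exists>y\<in>S. \<exists>z\<in>S. x = y + z)} = range \<beta>"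
proof (intro equalityI subsetI)
  have inS: "of_int e * \<beta> j + of_int f * \<beta> (j + 1) \<in> S" if "e \<ge> 1" "f \<ge> 0" for e f j
    using that S by blast
  fix x assume "x \<in> {x \<in> S. \<not> (\<exists>y\<in>S. \<exists>z\<in>S. x = y + z)}"
  then have "x \<in> S" and ind: "\<And>y z. y \<in> S \<Longrightarrow> z \<in> S \<Longrightarrow> x \<noteq> y + z" by auto
  then obtain j e f where ef: "e \<ge> 1" "f \<ge> 0" and x: "x = of_int e * \<beta> j + of_int f * \<beta> (j + 1)"
    using S by blast
  have "e = 1"
  proof (rule ccontr)
    assume "e \<noteq> 1"
    with ef ind[OF inS[of 1 0 j] inS[of "e - 1" f j]] x show False by (simp add: algebra_simps)
  qed
  moreover have "f = 0"
  proof (rule ccontr)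
    assume "f \<noteq> 0"
    with ef ind[OF inS[of 1 0 j] inS[of f 0 "j + 1"]] x \<open>e = 1\<close> show False by simp
  qed
  ultimately show "x \<in> range \<beta>" using x by simp
next
  have mset: "\<exists>N. N \<noteq> {#} \<and> (\<Sum>k\<in>#N. \<beta> k) = y" if "y \<in> S" for y
  proof -
    from that S obtain j e f where "e \<ge> 1" "f \<ge> 0" "y = of_int e * \<beta> j + of_int f * \<beta> (j + 1)"
      by blast
    then show ?thesis
      by (intro exI[of _ "trivial_rep j e f"]) (auto simp: sum_trivial_rep, simp add: trivial_rep_def)
  qed
  fix x assume "x \<in> range \<beta>"
  then obtain j where x: "x = \<beta> j" by blast
  have "x \<in> S" unfolding S x by (intro exI[of _ j] exI[of _ 1] exI[of _ 0]) simp
  moreover have "x \<noteq> y + z" if yz: "y \<in> S" "z \<in> S" for y z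
  proof
    assume "x = y + z"
    obtain M N where MN: "M \<noteq> {#}" "(\<Sum>k\<in>#M. \<beta> k) = y" "N \<noteq> {#}" "(\<Sum>k\<in>#N. \<beta> k) = z"
      using mset yz by metis
    with \<open>x = y + z\<close> x have "(\<Sum>k\<in>#M + N. \<beta> k) = of_int 1 * \<beta> j + of_int 0 * \<beta> (j + 1)" by simp
    from small_coords[OF this] have "M + N = trivial_rep j 1 0"
      using v_ge_2[of j] v_ge_2[of "j + 1"] by auto
    then have "size M + size N = 1" by (metis size_union trivial_rep_def nat_0 nat_one_as_int nat_1 size_replicate_mset replicate_mset_0 add.right_neutral One_nat_def)
    with MN show False by (auto simp: nonempty_has_size)
  qed
  ultimately show "x \<in> {x \<in> S. \<not> (\<exists>y\<in>S. \<exists>z\<in>S. x = y + z)}" by blast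
qed

lemma coords_exist:
  assumes "x = of_int a * \<beta> 0 + of_int b * \<beta> 1"
  shows "\<exists>c d. x = of_int c * \<beta> j + of_int d * \<beta> (j + 1)"
proof (induction j rule: int_induct[where k = 0])
  case base
  then show ?case using assms by auto
next
  case (step1 j)
  then obtain c d where "x = of_int c * \<beta> j + of_int d * \<beta> (j + 1)" by blast
  also have "\<beta> j = of_int (v (j + 1)) * \<beta> (j + 1) - \<beta> (j + 1 + 1)"
    using recurrence[of "j + 1"] by simp
  finally have "x = of_int (c * v (j + 1) + d) * \<beta> (j + 1) + of_int (- c) * \<beta> (j + 1 + 1)"
    by (simp add: algebra_simps)
  then show ?case by blast
next
  case (step2 j)
  then obtain c d where "x = of_int c * \<beta> j + of_int d * \<beta> (j + 1)" by blast
  also have "\<beta> (j + 1) = of_int (v j) * \<beta> j - \<beta> (j - 1)"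
    using recurrence[of j] by simp
  finally have "x = of_int (- d) * \<beta> (j - 1) + of_int (c + d * v j) * \<beta> (j - 1 + 1)"
    by (simp add: algebra_simps)
  then show ?case by blast
qed

text \<open>Comparing the expansions at \<open>j - 1\<close> and \<open>j\<close> shows that each
  second coordinate is minus the preceding first one. Thus \<open>x\<close> lies in the cone at
  \<open>j\<close> when \<open>g j > 0\<close> and \<open>g (j - 1) \<le> 0\<close>.\<close>

lemma coord_sequence_exists:
  assumes "x = of_int a * \<beta> 0 + of_int b * \<beta> 1"
  obtains g where "\<And>j. x = of_int (g j) * \<beta> j - of_int (g (j - 1)) * \<beta> (j + 1)"
proof -
  have "\<forall>j. \<exists>c d. x = of_int c * \<beta> j + of_int d * \<beta> (j + 1)"
    using coords_exist[OF assms] by blast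
  then obtain g h where gh: "\<And>j. x = of_int (g j) * \<beta> j + of_int (h j) * \<beta> (j + 1)" by metis
  have h: "h j = - g (j - 1)" for j
  proof -
    have "of_int (g j) * \<beta> j + of_int (h j) * \<beta> (j + 1)
        = of_int (g (j - 1)) * \<beta> (j - 1) + of_int (h (j - 1)) * \<beta> j"
      using gh[of j] gh[of "j - 1"] by simp
    also have "\<dots> = of_int (g (j - 1) * v j + h (j - 1)) * \<beta> j + of_int (- g (j - 1)) * \<beta> (j + 1)"
      unfolding beta_prev[of j] by (simp add: algebra_simps)
    finally show ?thesis using coords_unique by blast
  qed
  have "x = of_int (g j) * \<beta> j - of_int (g (j - 1)) * \<beta> (j + 1)" for j
    using gh[of j] unfolding h[of j] by simp
  then show thesis by (rule that)
qed

end

section \<open>Integers of a real quadratic field\<close>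

locale real_quadratic =
  fixes D :: nat
  assumes D_ge_2: "D \<ge> 2" and squarefree_D: "squarefree D"
begin

abbreviation s :: real where "s \<equiv> sqrt (real D)"

lemma sqrt_irrational: "s \<notin> \<rat>"
proof
  assume "s \<in> \<rat>"
  then have "s \<in> \<int>" by (intro rational_algebraic_int_is_int) auto
  then obtain k :: int where k: "s = of_int k" by (elim Ints_cases)
  have "real D = s ^ 2" by simp
  then have "real D = of_int (k ^ 2)" by (simp add: k)
  then have "int D = k ^ 2" by linarith
  then have D: "D = nat \<bar>k\<bar> ^ 2" by (metis nat_abs_int_diff nat_int nat_power_eq abs_ge_zero power2_abs)
  then have "nat \<bar>k\<bar> dvd 1" using squarefree_D by (intro squarefreeD[of D]) simp_all
  with D D_ge_2 show False by simp
qed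

lemma rat_coords_unique:
  assumes "a \<in> \<rat>" "b \<in> \<rat>" "c \<in> \<rat>" "d \<in> \<rat>" "a + b * s = c + d * s"
  shows "a = c \<and> b = d"
proof -
  have "b = d"
  proof (rule ccontr)
    assume "b \<noteq> d"
    then have "s = (c - a) / (b - d)" using assms(5) by (simp add: field_simps)
    also have "\<dots> \<in> \<rat>" using assms by simp
    finally show False using sqrt_irrational by simp
  qed
  with assms show ?thesis by simp
qed

lemma conjugate_eq:
  assumes "a \<in> \<rat>" "b \<in> \<rat>"
  shows "conjugate D (a + b * s) = a - b * s"
  unfolding conjugate_def
proof (rule the_equality)
  fix y assume "\<exists>c\<in>\<rat>. \<exists>d\<in>\<rat>. a + b * s = c + d * s \<and> y = c - d * s"
  then obtain c d where "c \<in> \<rat>" "d \<in> \<rat>" "a + b * s = c + d * s" "y = c - d * s" by blast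
  with rat_coords_unique[of a b c d] assms show "y = a - b * s" by simp
qed (use assms in blast)

end

text \<open>All powers of the denominator \<open>q\<close> divide \<open>m\<close>; a
  \<open>q \<ge> 2\<close> would give \<open>q ^ m \<ge> 2 ^ m > m\<close>.\<close>

lemma int_if_bounded_denominators:
  fixes r :: real
  assumes "r \<in> \<rat>" "m > 0" "\<And>k. of_nat m * r ^ k \<in> \<int>"
  shows "r \<in> \<int>"
proof -
  obtain p q :: int where q: "q > 0" and cop: "coprime p q" and r: "r = of_int p / of_int q"
    using assms(1) by (rule Rats_cases')
  have "q ^ k dvd int m" for k
  proof -
    obtain z :: int where "of_nat m * r ^ k = of_int z" using assms(3)[of k] by (elim Ints_cases)
    then have "real_of_int (int m * p ^ k) = real_of_int (z * q ^ k)"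
      using q by (simp add: r power_divide field_simps)
    then have "int m * p ^ k = z * q ^ k" by (simp only: of_int_eq_iff)
    then have "q ^ k dvd int m * p ^ k" by simp
    moreover have "coprime (q ^ k) (p ^ k)" using cop by (simp add: coprime_commute)
    ultimately show ?thesis by (simp add: coprime_dvd_mult_left_iff)
  qed
  then have le: "q ^ m \<le> int m" using assms(2) by (intro zdvd_imp_le) auto
  have "q = 1"
  proof (rule ccontr)
    assume "q \<noteq> 1"
    with q have "2 \<le> q" by linarith
    then have "2 ^ m \<le> q ^ m" by (intro power_mono) auto
    moreover have "int m < 2 ^ m" by (metis of_nat_less_two_power)
    ultimately show False using le by linarith
  qed
  then show ?thesis using r by simp
qed

lemma common_denominator:
  fixes f :: "nat \<Rightarrow> real"
  assumes "\<And>k. f k \<in> \<rat>"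
  shows "\<exists>m>0. \<forall>k<n. real m * f k \<in> \<int>"
proof (induction n)
  case 0
  then show ?case by auto
next
  case (Suc n)
  then obtain m where m: "m > 0" "\<forall>k<n. real m * f k \<in> \<int>" by blast
  obtain p q :: int where q: "q > 0" "f n = of_int p / of_int q"
    using assms[of n] by (metis Rats_cases')
  have "real (m * nat q) * f k \<in> \<int>" if "k < Suc n" for k
  proof (cases "k = n")
    case True
    then have "real (m * nat q) * f k = of_int (int m * p)" using q by simp
    then show ?thesis by (simp only: Ints_of_int)
  next
    case False
    then have "real (m * nat q) * f k = of_int q * (real m * f k)" using q by simp
    also have "\<dots> \<in> \<int>" using m(2) False that by (intro Ints_mult[OF Ints_of_int]) simp
    finally show ?thesis .
  qed
  then show ?case using m q by (intro exI[of _ "m * nat q"]) auto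
qed

text \<open>A common denominator of the first \<open>n\<close> terms is inherited by all later ones,
  since the coefficients are integers.\<close>

lemma recurrence_bounded_denominators:
  fixes f :: "nat \<Rightarrow> real"
  assumes rat: "\<And>k. f k \<in> \<rat>" and int: "\<And>i. c i \<in> \<int>"
    and rec: "\<And>k. f (n + k) = - (\<Sum>i<n. c i * f (i + k))"
  shows "\<exists>m>0. \<forall>k. real m * f k \<in> \<int>"
proof -
  obtain m where m: "m > 0" "\<forall>k<n. real m * f k \<in> \<int>"
    using common_denominator[of f n] rat by blast
  have "real m * f k \<in> \<int>" for k
  proof (induction k rule: less_induct)
    case (less k)
    show ?case
    proof (cases "k < n")
      case False
      then have "f k = - (\<Sum>i<n. c i * f (i + (k - n)))" using rec[of "k - n"] by simp
      then have "real m * f k = - (\<Sum>i<n. c i * (real m * f (i + (k - n))))"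
        by (simp add: sum_distrib_left algebra_simps)
      also have "\<dots> \<in> \<int>"
      proof (intro Ints_minus Ints_sum)
        fix i assume "i \<in> {..<n}"
        then have "real m * f (i + (k - n)) \<in> \<int>" using False by (intro less) auto
        then show "c i * (real m * f (i + (k - n))) \<in> \<int>" by (rule Ints_mult[OF int])
      qed
      finally show ?thesis .
    qed (use m in auto)
  qed
  with m show ?thesis by blast
qed

context real_quadratic
begin

text \<open>
  The coordinates of the powers of an algebraic integer satisfy an integral recurrence, so they have
  bounded denominators; hence so do the powers of the norm.
\<close>

lemma norm_in_Ints:
  assumes ab: "a \<in> \<rat>" "b \<in> \<rat>" and alg: "algebraic_int (a + b * s)"
  shows "a ^ 2 - real D * b ^ 2 \<in> \<int>"
proof -
  define x where "x = a + b * s"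
  obtain p where p: "lead_coeff p = 1" "\<forall>i. coeff p i \<in> \<int>" "poly p x = 0"
    using alg unfolding x_def by (auto elim: algebraic_int.cases)
  define n where "n = degree p"
  \<comment> \<open>Iterated multiplication by \<open>x\<close> on coordinate pairs:
    \<open>A k\<close> and \<open>B k\<close> are the coordinates of \<open>x ^ k\<close>.\<close>
  define c where "c = rec_nat (1 :: real, 0 :: real)
    (\<lambda>_ (A, B). (a * A + real D * b * B, a * B + b * A))"
  define A B where "A k = fst (c k)" and "B k = snd (c k)" for k
  have A0: "A 0 = 1" "B 0 = 0" by (simp_all add: A_def B_def c_def)
  have AS: "A (Suc k) = a * A k + real D * b * B k" "B (Suc k) = a * B k + b * A k" for k
    by (simp_all add: A_def B_def c_def split: prod.splits)
  have ss: "s * (s * y) = real D * y" for y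
    by (simp add: mult.assoc[symmetric])
  have rat: "A k \<in> \<rat> \<and> B k \<in> \<rat>" for k
    by (induction k) (auto simp: A0 AS ab)
  have pow: "x ^ k = A k + B k * s" for k
    by (induction k) (simp_all add: A0 AS x_def algebra_simps ss)
  have norm: "A k ^ 2 - real D * B k ^ 2 = (a ^ 2 - real D * b ^ 2) ^ k" for k
  proof (induction k)
    case (Suc k)
    have "A (Suc k) ^ 2 - real D * B (Suc k) ^ 2
        = (a ^ 2 - real D * b ^ 2) * (A k ^ 2 - real D * B k ^ 2)"
      unfolding AS by (simp add: power2_eq_square algebra_simps)
    with Suc show ?case by simp
  qed (simp add: A0)
  \<comment> \<open>The monic equation \<open>poly p x = 0\<close>, multiplied by
    \<open>x ^ k\<close> and read off in both coordinates.\<close>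
  have rec: "A (n + k) = - (\<Sum>i<n. coeff p i * A (i + k)) \<and> B (n + k) = - (\<Sum>i<n. coeff p i * B (i + k))" for k
  proof -
    have "(\<Sum>i\<le>n. coeff p i * x ^ i) = 0" using p(3) by (simp add: poly_altdef n_def)
    then have "(\<Sum>i<n. coeff p i * x ^ i) + x ^ n = 0"
      using p(1) by (simp add: n_def lessThan_Suc_atMost[symmetric])
    then have "((\<Sum>i<n. coeff p i * x ^ i) + x ^ n) * x ^ k = 0" by simp
    then have "(\<Sum>i<n. coeff p i * x ^ (i + k)) + x ^ (n + k) = 0"
      by (simp add: algebra_simps power_add sum_distrib_left)
    then have "A (n + k) + B (n + k) * s
       = - (\<Sum>i<n. coeff p i * A (i + k)) + (- (\<Sum>i<n. coeff p i * B (i + k))) * s"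
      unfolding pow by (simp add: algebra_simps sum.distrib sum_distrib_left)
    moreover have "coeff p i \<in> \<rat>" for i using p(2) Ints_subset_Rats by blast
    ultimately show ?thesis using rat by (intro rat_coords_unique) auto
  qed
  obtain m1 where m1: "m1 > 0" and dA: "\<And>k. real m1 * A k \<in> \<int>"
    using recurrence_bounded_denominators[of A "coeff p" n] rat rec p(2) by blast
  obtain m2 where m2: "m2 > 0" and dB: "\<And>k. real m2 * B k \<in> \<int>"
    using recurrence_bounded_denominators[of B "coeff p" n] rat rec p(2) by blast
  show ?thesis
  proof (rule int_if_bounded_denominators)
    show "a ^ 2 - real D * b ^ 2 \<in> \<rat>" using ab by simp
    show "(m1 * m2) ^ 2 > 0" using m1 m2 by simp
    show "real ((m1 * m2) ^ 2) * (a ^ 2 - real D * b ^ 2) ^ k \<in> \<int>" for k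
    proof -
      have "real ((m1 * m2) ^ 2) * (a ^ 2 - real D * b ^ 2) ^ k
         = real (m2 ^ 2) * (real m1 * A k) ^ 2 - real (m1 ^ 2 * D) * (real m2 * B k) ^ 2"
        unfolding norm[symmetric] by (simp add: power_mult_distrib algebra_simps)
      also have "\<dots> \<in> \<int>" by (intro Ints_diff Ints_mult Ints_power dA dB) auto
      finally show ?thesis .
    qed
  qed
qed

text \<open>The norms of \<open>x + 1\<close> and \<open>x\<close> differ by
  \<open>2 * a + 1\<close>.\<close>

lemma trace_in_Ints:
  assumes ab: "a \<in> \<rat>" "b \<in> \<rat>" and alg: "algebraic_int (a + b * s)"
  shows "2 * a \<in> \<int>"
proof -
  have "algebraic_int ((a + 1) + b * s)"
    by (rule algebraic_int_root[OF alg, of "[:-1, 1:]"])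
       (auto simp: coeff_pCons split: nat.splits)
  then have "(a + 1) ^ 2 - real D * b ^ 2 \<in> \<int>" using ab by (intro norm_in_Ints) auto
  then have "((a + 1) ^ 2 - real D * b ^ 2) - (a ^ 2 - real D * b ^ 2) - 1 \<in> \<int>"
    by (rule Ints_diff[OF Ints_diff[OF _ norm_in_Ints[OF assms]] Ints_1])
  then show ?thesis by (simp add: power2_eq_square algebra_simps)
qed

section \<open>The integral basis \<open>1\<close>, \<open>xi D\<close>\<close>

lemma D_mod_4: "D mod 4 \<noteq> 0"
proof
  assume "D mod 4 = 0"
  then have "2 ^ 2 dvd D" by (simp add: dvd_eq_mod_eq_0)
  with squarefree_D have "(2::nat) dvd 1" by (rule squarefreeD)
  then show False by simp
qed

text \<open>The square of the denominator of \<open>c\<close> divides the squarefree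
  \<open>D\<close>.\<close>

lemma int_if_D_times_square_int:
  assumes "c \<in> \<rat>" "real D * c ^ 2 \<in> \<int>"
  shows "c \<in> \<int>"
proof -
  obtain p q :: int where q: "q > 0" and cop: "coprime p q" and c: "c = of_int p / of_int q"
    using assms(1) by (rule Rats_cases')
  obtain z :: int where "real D * c ^ 2 = of_int z" using assms(2) by (elim Ints_cases)
  then have "real_of_int (int D * p ^ 2) = real_of_int (z * q ^ 2)"
    using q by (simp add: c power_divide field_simps)
  then have "int D * p ^ 2 = z * q ^ 2" by (simp only: of_int_eq_iff)
  then have "q ^ 2 dvd int D * p ^ 2" by simp
  moreover have "coprime (q ^ 2) (p ^ 2)" using cop by (simp add: coprime_commute)
  ultimately have "q ^ 2 dvd int D" by (simp add: coprime_dvd_mult_left_iff)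
  then have "nat q ^ 2 dvd D" using q
    by (metis int_dvd_int_iff int_nat_eq less_imp_le of_nat_power)
  with squarefree_D have "nat q dvd 1" by (rule squarefreeD)
  then have "q = 1" using q by simp
  then show ?thesis using c by simp
qed

definition omega_trace :: int where "omega_trace = (if D mod 4 = 1 then 1 else 0)"

lemma omega_eq: "omega D = xi D + of_int omega_trace"
  by (simp add: omega_def xi_def omega_trace_def field_simps)

text \<open>A common shape for both residue classes, showing that \<open>xi D\<close> and
  \<open>- omega D\<close> are conjugate.\<close>

lemma xi_rat: obtains h k where "h \<in> \<rat>" "k \<in> \<rat>" "k > 0" "xi D = h + k * s" "omega D = - h + k * s"
proof (cases "D mod 4 = 1")
  case True
  show thesis
    by (rule that[of "-1/2" "1/2"]) (use True in \<open>auto simp: xi_def omega_def field_simps\<close>)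
next
  case False
  show thesis
    by (rule that[of 0 1]) (use False in \<open>auto simp: xi_def omega_def\<close>)
qed

lemma conjugate_xi: "conjugate D (of_int a + of_int b * xi D) = of_int a - of_int b * omega D"
proof -
  obtain h k where hk: "h \<in> \<rat>" "k \<in> \<rat>" "xi D = h + k * s" "omega D = - h + k * s"
    by (rule xi_rat)
  have "of_int a + of_int b * xi D = (of_int a + of_int b * h) + (of_int b * k) * s"
    unfolding hk by (simp add: algebra_simps)
  moreover have "conjugate D ((of_int a + of_int b * h) + (of_int b * k) * s)
      = (of_int a + of_int b * h) - (of_int b * k) * s"
    using hk by (intro conjugate_eq) auto
  ultimately show ?thesis unfolding hk by (simp add: algebra_simps)
qed

lemma xi_independent:
  assumes "of_int a + of_int b * xi D = 0"
  shows "a = 0 \<and> b = 0"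
proof -
  obtain h k where "h \<in> \<rat>" "k \<in> \<rat>" "k > 0" "xi D = h + k * s" by (rule xi_rat)
  then show ?thesis
    using rat_coords_unique[of "of_int a + of_int b * h" "of_int b * k" 0 0] assms
    by (auto simp: algebra_simps)
qed

text \<open>Write \<open>x\<close> as half of \<open>t + c * s\<close>. Integrality of trace and
  norm makes \<open>t ^ 2 - D * c ^ 2\<close> divisible by 4, and squares modulo 4 settle the
  parities.\<close>

lemma ring_of_ints_iff: "x \<in> ring_of_ints D \<longleftrightarrow> (\<exists>a b :: int. x = of_int a + of_int b * xi D)"
proof
  assume "x \<in> ring_of_ints D"
  then obtain a b where ab: "a \<in> \<rat>" "b \<in> \<rat>" and x: "x = a + b * s" and alg: "algebraic_int (a + b * s)"
    by (auto simp: ring_of_ints_def quad_field_def)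
  obtain t :: int where t: "2 * a = of_int t" using trace_in_Ints[OF ab alg] by (elim Ints_cases)
  obtain N :: int where N: "a ^ 2 - real D * b ^ 2 = of_int N"
    using norm_in_Ints[OF ab alg] by (elim Ints_cases)
  have "real D * (2 * b) ^ 2 = (2 * a) ^ 2 - 4 * (a ^ 2 - real D * b ^ 2)"
    by (simp add: power_mult_distrib)
  then have Db: "real D * (2 * b) ^ 2 = of_int (t ^ 2 - 4 * N)" unfolding t N by simp
  have "2 * b \<in> \<int>"
    by (rule int_if_D_times_square_int) (use ab in simp, simp only: Db Ints_of_int)
  then obtain c :: int where c: "2 * b = of_int c" by (elim Ints_cases)
  from Db have "real_of_int (int D * c ^ 2) = of_int (t ^ 2 - 4 * N)" unfolding c by simp
  then have eq: "int D * c ^ 2 = t ^ 2 - 4 * N" by (simp only: of_int_eq_iff)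
  have x': "2 * x = of_int t + of_int c * s" using x t c by (simp add: algebra_simps)
  have "int (D mod 4) * c ^ 2 = t ^ 2 - 4 * (N + int (D div 4) * c ^ 2)"
  proof -
    have "int D = 4 * int (D div 4) + int (D mod 4)" by (simp add: zdiv_int zmod_int)
    with eq show ?thesis by (simp add: algebra_simps)
  qed
  then obtain M :: int where M: "int (D mod 4) * c ^ 2 = t ^ 2 - 4 * M" by blast
  have par: "t ^ 2 mod 4 = (if even t then 0 else 1)" for t :: int
  proof (cases "even t")
    case True
    then obtain u where "t = 2 * u" by (elim evenE)
    then show ?thesis by (simp add: power2_eq_square)
  next
    case False
    then obtain u where "t = 2 * u + 1" by (elim oddE)
    then have "t ^ 2 = 1 + 4 * (u ^ 2 + u)" by (simp add: power2_eq_square algebra_simps)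
    then have "t ^ 2 mod 4 = 1" by (simp only: mod_mult_self2) simp
    with False show ?thesis by simp
  qed
  have M': "(int (D mod 4) * (c ^ 2 mod 4)) mod 4 = t ^ 2 mod 4"
    using M by (metis mod_mult_right_eq mod_diff_right_eq mod_mult_self1_is_0 diff_zero)
  have "D mod 4 = 1 \<or> D mod 4 = 2 \<or> D mod 4 = 3" using D_mod_4 by linarith
  then show "\<exists>a b :: int. x = of_int a + of_int b * xi D"
  proof (elim disjE)
    assume D: "D mod 4 = 1"
    with M' par[of t] par[of c] have "even (t + c)" by (auto split: if_splits)
    then obtain u where u: "t + c = 2 * u" by (elim evenE)
    then have "real_of_int t + of_int c = 2 * of_int u" by (metis of_int_add of_int_mult of_int_numeral)
    with x' have "x = of_int u + of_int c * xi D" using D by (simp add: xi_def field_simps)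
    then show ?thesis by blast
  next
    assume "D mod 4 = 2"
    with M' par[of t] par[of c] have "even t" "even c" by (auto split: if_splits)
    then obtain u w where "t = 2 * u" "c = 2 * w" by (elim evenE)
    with x' have "x = of_int u + of_int w * xi D" using \<open>D mod 4 = 2\<close> by (simp add: xi_def)
    then show ?thesis by blast
  next
    assume "D mod 4 = 3"
    with M' par[of t] par[of c] have "even t" "even c" by (auto split: if_splits)
    then obtain u w where "t = 2 * u" "c = 2 * w" by (elim evenE)
    with x' have "x = of_int u + of_int w * xi D" using \<open>D mod 4 = 3\<close> by (simp add: xi_def)
    then show ?thesis by blast
  qed
next
  assume "\<exists>a b :: int. x = of_int a + of_int b * xi D"
  then obtain a b :: int where x: "x = of_int a + of_int b * xi D" by blast
  obtain h k where "h \<in> \<rat>" "k \<in> \<rat>" "xi D = h + k * s" by (rule xi_rat)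
  then have "x = (of_int a + of_int b * h) + (of_int b * k) * s" "of_int a + of_int b * h \<in> \<rat>"
    "of_int b * k \<in> \<rat>" using x by (simp_all add: algebra_simps)
  then have "x \<in> quad_field D" unfolding quad_field_def by blast
  moreover have "algebraic_int x"
  proof -
    \<comment> \<open>\<open>k\<close> is minus the norm of \<open>xi D\<close>.\<close>
    obtain k :: int where k: "xi D ^ 2 + of_int omega_trace * xi D - of_int k = 0"
    proof (cases "D mod 4 = 1")
      case True
      have "real D = 4 * real (D div 4) + 1"
        using True by (metis div_mult_mod_eq mult.commute of_nat_1 of_nat_add of_nat_mult of_nat_numeral)
      then have "xi D ^ 2 + of_int omega_trace * xi D - of_int (int (D div 4)) = 0"
        using True by (simp add: omega_trace_def xi_def power2_eq_square field_simps)
      then show thesis by (rule that)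
    next
      case False
      then have "xi D ^ 2 + of_int omega_trace * xi D - of_int (int D) = 0"
        by (simp add: omega_trace_def xi_def)
      then show thesis by (rule that)
    qed
    \<comment> \<open>The characteristic polynomial of \<open>x\<close>, built from its norm and
      trace.\<close>
    let ?p = "[:of_int (a ^ 2 - omega_trace * a * b - b ^ 2 * k), of_int (omega_trace * b - 2 * a), 1:] :: real poly"
    have "poly ?p x = of_int b ^ 2 * (xi D ^ 2 + of_int omega_trace * xi D - of_int k)"
      by (simp add: x power2_eq_square algebra_simps)
    then have "poly ?p x = 0" using k by simp
    moreover have "\<forall>i. coeff ?p i \<in> \<int>" by (auto simp: coeff_pCons split: nat.splits)
    ultimately show ?thesis by (intro algebraic_int.intros[of ?p]) auto
  qed
  ultimately show "x \<in> ring_of_ints D" by (simp add: ring_of_ints_def)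
qed

section \<open>Pure periodicity of the continued fraction\<close>

lemma s_gt_1: "s > 1"
  using D_ge_2 by simp

lemma omega_trace_cases: "omega_trace = 0 \<or> omega_trace = 1"
  by (simp add: omega_trace_def)

definition a0 :: int where "a0 = \<lfloor>omega D\<rfloor>"

text \<open>The starting value differs from \<open>omega D\<close> by an integer, so the complete
  quotients agree from index 1 on; being reduced, it makes the period begin at index 0.\<close>

definition zeta :: "nat \<Rightarrow> real" where "zeta n = complete_quotient (of_int a0 + xi D) n"

lemma zeta_0: "zeta 0 = of_int a0 + xi D"
  by (simp add: zeta_def)

lemma zeta_Suc: "zeta (Suc n) = 1 / (zeta n - of_int \<lfloor>zeta n\<rfloor>)"
  by (simp add: zeta_def)

lemma floor_zeta_0: "\<lfloor>zeta 0\<rfloor> = 2 * a0 - omega_trace"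
proof -
  have "zeta 0 = omega D + of_int (a0 - omega_trace)" by (simp add: zeta_0 omega_eq)
  then show ?thesis by (simp add: a0_def)
qed

lemma complete_quotient_omega: "complete_quotient (omega D) (Suc n) = zeta (Suc n)"
proof (induction n)
  case 0
  have "omega D - of_int \<lfloor>omega D\<rfloor> = zeta 0 - of_int \<lfloor>zeta 0\<rfloor>"
    unfolding floor_zeta_0 by (simp add: zeta_0 omega_eq a0_def)
  then show ?case by (simp add: zeta_Suc)
next
  case (Suc n)
  then show ?case unfolding zeta_Suc[of "Suc n"] complete_quotient.simps(2)[of _ "Suc n"] by simp
qed

text \<open>The last two inequalities place the Galois conjugate of \<open>x\<close> in
  \<open>(-1, 0)\<close>; the divisibility keeps the next denominator integral.\<close>

definition reduced_repr :: "int \<Rightarrow> int \<Rightarrow> real \<Rightarrow> bool" where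
  "reduced_repr P Q x \<longleftrightarrow> Q > 0 \<and> Q dvd (int D - P ^ 2) \<and> x = (of_int P + s) / of_int Q
     \<and> x > 1 \<and> (of_int P - s) / of_int Q > -1 \<and> (of_int P - s) / of_int Q < 0"

definition reduced :: "real \<Rightarrow> bool" where
  "reduced x \<longleftrightarrow> (\<exists>P Q. reduced_repr P Q x)"

text \<open>The inequalities give \<open>\<bar>P\<bar> < s\<close> and
  \<open>0 < Q < 2 * s\<close>.\<close>

lemma finite_reduced: "finite {x. reduced x}"
proof -
  define b :: int where "b = \<lceil>2 * s\<rceil>"
  have "{x. reduced x} \<subseteq> (\<lambda>(P, Q). (of_int P + s) / of_int Q) ` ({- b..b} \<times> {- b..b})"
  proof
    fix x assume "x \<in> {x. reduced x}"
    then obtain P Q where Q: "Q > 0" and x: "x = (of_int P + s) / of_int Q" "x > 1"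
      and c: "(of_int P - s) / of_int Q < 0"
      by (auto simp: reduced_def reduced_repr_def)
    have "real_of_int P < s" using c Q by (simp add: divide_less_0_iff)
    moreover have "of_int Q < of_int P + s" using x(2) Q unfolding x(1) by (simp add: less_divide_eq)
    moreover have "real_of_int Q > 0" using Q by simp
    ultimately have "\<bar>real_of_int P\<bar> \<le> 2 * s" "\<bar>real_of_int Q\<bar> \<le> 2 * s" by linarith+
    then have "\<bar>P\<bar> \<le> b" "\<bar>Q\<bar> \<le> b" unfolding b_def by linarith+
    then have "(P, Q) \<in> {- b..b} \<times> {- b..b}" by auto
    then show "x \<in> (\<lambda>(P, Q). (of_int P + s) / of_int Q) ` ({- b..b} \<times> {- b..b})"
      by (rule rev_image_eqI) (simp add: x)
  qed
  then show ?thesis by (rule finite_subset) simp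
qed

text \<open>The conjugates differ by the same integer, but both lie in
  \<open>(-1, 0)\<close>.\<close>

lemma reduced_eq_if_diff_int:
  assumes "reduced x" "reduced y" "x - y = of_int k"
  shows "x = y"
proof -
  obtain P Q where Q: "Q > 0" and x: "x = (of_int P + s) / of_int Q"
    and xc: "(of_int P - s) / of_int Q > -1" "(of_int P - s) / of_int Q < 0"
    using assms(1) by (auto simp: reduced_def reduced_repr_def)
  obtain P' Q' where Q': "Q' > 0" and y: "y = (of_int P' + s) / of_int Q'"
    and yc: "(of_int P' - s) / of_int Q' > -1" "(of_int P' - s) / of_int Q' < 0"
    using assms(2) by (auto simp: reduced_def reduced_repr_def)
  have "of_int P / of_int Q + (1 / of_int Q) * s
      = (of_int P' / of_int Q' + of_int k) + (1 / of_int Q') * s"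
    using assms(3) x y by (simp add: add_divide_distrib)
  then have *: "real_of_int P / of_int Q = of_int P' / of_int Q' + of_int k \<and> 1 / real_of_int Q = 1 / of_int Q'"
    by (rule rat_coords_unique[rotated 4]) auto
  then have QQ: "Q = Q'" by simp
  then have "(of_int P - s) / of_int Q - (of_int P' - s) / of_int Q' = of_int k"
    using * by (simp add: diff_divide_distrib)
  with xc yc have "\<bar>real_of_int k\<bar> < 1" by linarith
  then have "k = 0" by linarith
  with assms(3) show ?thesis by simp
qed

lemma reduced_step:
  assumes "reduced x"
  shows "reduced (1 / (x - of_int \<lfloor>x\<rfloor>))"
proof -
  obtain P Q where Q: "Q > 0" and dv: "Q dvd (int D - P ^ 2)" and x: "x = (of_int P + s) / of_int Q"
    and x1: "x > 1" and xc: "(of_int P - s) / of_int Q > -1" "(of_int P - s) / of_int Q < 0"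
    using assms by (auto simp: reduced_def reduced_repr_def)
  define a where "a = \<lfloor>x\<rfloor>"
  have a1: "a \<ge> 1" using x1 unfolding a_def by linarith
  \<comment> \<open>The classical recursion: \<open>P' = a * Q - P\<close> and
    \<open>Q * Q' = D - P' ^ 2\<close>.\<close>
  define P' where "P' = a * Q - P"
  have "Q dvd (int D - P' ^ 2)"
  proof -
    have "int D - P' ^ 2 = (int D - P ^ 2) + Q * (2 * a * P - a ^ 2 * Q)"
      by (simp add: P'_def power2_eq_square algebra_simps)
    then show ?thesis using dv by (simp only: dvd_add dvd_triv_left)
  qed
  then obtain Q' where Q': "int D - P' ^ 2 = Q * Q'" by (elim dvdE)
  have irr: "x \<noteq> of_int a"
  proof
    assume "x = of_int a"
    then have "s = of_int (a * Q - P)" using x Q by (simp add: field_simps)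
    then show False using sqrt_irrational by (metis Rats_of_int)
  qed
  have fr: "0 < x - of_int a" "x - of_int a < 1" using irr unfolding a_def by linarith+
  have xa: "x - of_int a = (s - of_int P') / of_int Q" using Q x by (simp add: P'_def field_simps)
  have prod: "(s - of_int P') * (s + of_int P') = of_int Q * of_int Q'"
  proof -
    have "(s - of_int P') * (s + of_int P') = s ^ 2 - of_int P' ^ 2"
      by (simp add: power2_eq_square algebra_simps)
    also have "s ^ 2 - of_int P' ^ 2 = of_int (int D - P' ^ 2)" by simp
    finally show ?thesis unfolding Q' by simp
  qed
  have sP: "s - of_int P' > 0" using fr(1) Q unfolding xa by (simp add: zero_less_divide_iff)
  \<comment> \<open>The conjugate of \<open>x - a\<close>. It is below \<open>-1\<close> as the
    conjugate of \<open>x\<close> is negative and \<open>a \<ge> 1\<close>, so \<open>1 / y\<close>,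
    the conjugate of the next quotient, lies in \<open>(-1, 0)\<close>.\<close>
  define y where "y = (of_int P - s) / of_int Q - of_int a"
  have "real_of_int a \<ge> 1" using a1 by simp
  then have "y < -1" using xc(2) unfolding y_def by linarith
  moreover have "y = - (of_int P' + s) / of_int Q" using Q by (simp add: y_def P'_def field_simps)
  ultimately have y: "y < -1" "y = - (of_int P' + s) / of_int Q" .
  have sP': "of_int P' + s > 0"
  proof -
    have "- (of_int P' + s) / of_int Q < 0" using y by linarith
    then show ?thesis using Q by (simp add: divide_less_0_iff)
  qed
  have "real_of_int Q * of_int Q' > 0" unfolding prod[symmetric] using sP sP' by (simp add: add.commute)
  then have Qp: "Q' > 0" using Q by (simp add: zero_less_mult_iff)
  have n: "1 / (x - of_int a) = (of_int P' + s) / of_int Q'"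
    using prod sP Q Qp unfolding xa by (simp add: field_simps)
  have m: "1 / y = (of_int P' - s) / of_int Q'"
    using prod sP' Q Qp unfolding y(2) by (simp add: field_simps)
  have "reduced_repr P' Q' (1 / (x - of_int a))"
    unfolding reduced_repr_def
  proof (intro conjI)
    show "Q' > 0" by fact
    show "Q' dvd int D - P' ^ 2" unfolding Q' by simp
    show "1 / (x - of_int a) = (of_int P' + s) / of_int Q'" by fact
    show "1 < 1 / (x - of_int a)" using fr by simp
    show "- 1 < (of_int P' - s) / of_int Q'" "(of_int P' - s) / of_int Q' < 0"
      unfolding m[symmetric] using y(1) by (simp_all add: field_simps)
  qed
  then show ?thesis unfolding reduced_def a_def by blast
qed

section \<open>Periodicity from index 0 and the value of \<open>u_coeff D 0\<close>\<close>

lemma omega_irrational: "omega D \<noteq> of_int n"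
proof
  assume "omega D = of_int n"
  then have "of_int (omega_trace - n) + of_int 1 * xi D = 0" by (simp add: omega_eq)
  with xi_independent[of "omega_trace - n" 1] show False by simp
qed

lemma a0_bounds: "of_int a0 < omega D" "omega D < of_int a0 + 1" "a0 \<ge> 1" "xi D > 0"
proof -
  show "of_int a0 < omega D" using omega_irrational[of a0] unfolding a0_def by linarith
  show "omega D < of_int a0 + 1" unfolding a0_def by linarith
  have "omega D \<ge> 1" using s_gt_1 by (simp add: omega_def)
  then show "a0 \<ge> 1" unfolding a0_def by simp
  show "xi D > 0" using s_gt_1 by (simp add: xi_def)
qed

lemma reduced_zeta_0: "reduced (zeta 0)"
proof (cases "D mod 4 = 1")
  case True
  then have "D \<noteq> 2" "D \<noteq> 3" "D \<noteq> 4" by auto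
  with D_ge_2 have "D \<ge> 5" by linarith
  have xi: "xi D = (s - 1) / 2" "omega D = (s + 1) / 2" using True by (simp_all add: xi_def omega_def)
  have D: "int D mod 4 = 1" using True by (metis of_nat_1 of_nat_mod of_nat_numeral)
  have "even (int D - (2 * a0 - 1) ^ 2)"
  proof -
    have "odd (int D)" using D by presburger
    then show ?thesis by simp
  qed
  then have "reduced_repr (2 * a0 - 1) 2 (zeta 0)"
    using a0_bounds unfolding reduced_repr_def zeta_0 xi by (auto simp: field_simps)
  then show ?thesis unfolding reduced_def by blast
next
  case False
  then have xi: "xi D = s" "omega D = s" by (simp_all add: xi_def omega_def)
  have "real_of_int a0 \<ge> 1" using a0_bounds(3) by simp
  with a0_bounds s_gt_1 have "reduced_repr a0 1 (zeta 0)"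
    unfolding reduced_repr_def zeta_0 xi by simp
  then show ?thesis unfolding reduced_def by blast
qed

lemma reduced_zeta: "reduced (zeta n)"
  by (induction n) (auto simp: reduced_zeta_0 zeta_Suc reduced_step)

text \<open>Equal successors mean equal fractional parts, and reduced numbers differing by an
  integer coincide.\<close>

lemma zeta_Suc_inject: "zeta (Suc m) = zeta (Suc n) \<Longrightarrow> zeta m = zeta n"
proof -
  assume "zeta (Suc m) = zeta (Suc n)"
  then have "zeta m - zeta n = of_int (\<lfloor>zeta m\<rfloor> - \<lfloor>zeta n\<rfloor>)"
    unfolding zeta_Suc by simp
  with reduced_eq_if_diff_int[OF reduced_zeta reduced_zeta] show ?thesis by blast
qed

text \<open>Finiteness forces a repeated value; injectivity of the step moves the repetition back to
  index 0.\<close>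

lemma zeta_purely_periodic: "\<exists>t\<ge>1. \<forall>i. zeta (i + t) = zeta i"
proof -
  have "range zeta \<subseteq> {x. reduced x}" using reduced_zeta by auto
  then have "finite (range zeta)" using finite_reduced finite_subset by blast
  then have "\<not> inj zeta" using finite_imageD by blast
  then obtain m n where "m < n" "zeta m = zeta n"
    unfolding inj_def by (metis linorder_neqE_nat)
  then have "\<exists>t\<ge>1. zeta (0 + t) = zeta 0"
  proof (induction m arbitrary: n)
    case 0
    then show ?case by (intro exI[of _ n]) auto
  next
    case (Suc m)
    then obtain k where "n = Suc k" "m < k" by (metis Suc_lessE)
    with Suc.IH[of k] Suc.prems zeta_Suc_inject show ?case by blast
  qed
  then obtain t where t: "t \<ge> 1" "zeta (0 + t) = zeta 0" by blast
  have "zeta (i + t) = zeta i" for i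
    by (induction i) (use t in \<open>auto simp: zeta_Suc\<close>)
  with t show ?thesis by blast
qed

lemma u_coeff_eq: "u_coeff D n = \<lfloor>zeta n\<rfloor>"
proof (cases n)
  case (Suc k)
  then show ?thesis
    unfolding u_coeff_def partial_quotient_def Suc by (simp only: complete_quotient_omega nat.simps if_False)
next
  case 0
  have pq: "partial_quotient (omega D) i = \<lfloor>zeta i\<rfloor>" if "i \<ge> 1" for i
    using that complete_quotient_omega[of "i - 1"] by (simp add: partial_quotient_def)
  obtain t where t: "t \<ge> 1" "\<And>i. zeta (i + t) = zeta i" using zeta_purely_periodic by blast
  let ?P = "\<lambda>s. s \<ge> 1 \<and> (\<forall>i\<ge>1. partial_quotient (omega D) (i + s) = partial_quotient (omega D) i)"
  have "?P t" using t by (simp add: pq)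
  then have "?P (period D)" unfolding period_def by (rule LeastI)
  then have s: "period D \<ge> 1" "\<And>i. i \<ge> 1 \<Longrightarrow> \<lfloor>zeta (i + period D)\<rfloor> = \<lfloor>zeta i\<rfloor>"
    by (auto simp: pq)
  \<comment> \<open>\<open>period D\<close> is known as a period only from index 1 on, so index 0 is
    reached through \<open>t\<close>, a period of \<open>zeta\<close> from 0 on.\<close>
  have "\<lfloor>zeta (period D)\<rfloor> = \<lfloor>zeta (period D + t)\<rfloor>" using t(2) by simp
  also have "\<dots> = \<lfloor>zeta t\<rfloor>" using s(2)[of t] t(1) by (simp add: add.commute)
  also have "\<dots> = \<lfloor>zeta 0\<rfloor>" using t(2)[of 0] by simp
  finally show ?thesis using 0 s(1) pq by (simp add: u_coeff_def)
qed

lemma u_coeff_0: "u_coeff D 0 = 2 * a0 - omega_trace"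
  by (simp add: u_coeff_eq floor_zeta_0)

lemma u_coeff_ge_1: "u_coeff D n \<ge> 1"
  using reduced_zeta[of n] unfolding u_coeff_eq reduced_def reduced_repr_def by auto

lemma p_shift_1: "p_shift D (Suc 0) = a0"
proof -
  have "\<lceil>real_of_int (2 * a0 - omega_trace) / 2\<rceil> = a0"
    using omega_trace_cases by (intro ceiling_unique) auto
  then show ?thesis by (simp add: u_coeff_0)
qed

section \<open>The sequence of indecomposables\<close>

text \<open>Shifted by one: \<open>alpha_seq n\<close> is \<open>alpha D (n - 1)\<close>. Its
  conjugate is \<open>alpha_conj n\<close>.\<close>

definition alpha_seq :: "nat \<Rightarrow> real" where
  "alpha_seq n = of_int (p_shift D n) + of_int (q_shift D n) * xi D"

definition alpha_conj :: "nat \<Rightarrow> real" where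
  "alpha_conj n = of_int (p_shift D n) - of_int (q_shift D n) * omega D"

lemma alpha_seq_rec: "alpha_seq (n + 2) = of_int (u_coeff D (n + 1)) * alpha_seq (n + 1) + alpha_seq n"
  and alpha_conj_rec: "alpha_conj (n + 2) = of_int (u_coeff D (n + 1)) * alpha_conj (n + 1) + alpha_conj n"
  by (simp_all add: alpha_seq_def alpha_conj_def algebra_simps)

lemma alpha_seq_0: "alpha_seq 0 = 1" "alpha_conj 0 = 1"
  by (simp_all add: alpha_seq_def alpha_conj_def)

lemma alpha_seq_1: "alpha_seq 1 = of_int a0 + xi D" "alpha_conj 1 = of_int a0 - omega D"
  using p_shift_1 by (simp_all add: alpha_seq_def alpha_conj_def)

lemma alpha_seq_ge: "alpha_seq (Suc n) \<ge> xi D \<and> alpha_seq n > 0"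
proof (induction n)
  case 0
  then show ?case using alpha_seq_1 alpha_seq_0 a0_bounds(3) by simp
next
  case (Suc n)
  have "1 * alpha_seq (Suc n) \<le> of_int (u_coeff D (n + 1)) * alpha_seq (Suc n)"
    using Suc a0_bounds(4) u_coeff_ge_1[of "n + 1"] by (intro mult_right_mono) auto
  moreover have "alpha_seq (Suc (Suc n)) = of_int (u_coeff D (n + 1)) * alpha_seq (Suc n) + alpha_seq n"
    using alpha_seq_rec[of n] by simp
  ultimately show ?case using Suc a0_bounds(4) by linarith
qed

text \<open>Consecutive conjugates have minus a complete quotient as their ratio; complete quotients
  are positive, so the signs alternate.\<close>

lemma alpha_conj_zeta: "alpha_conj (Suc n) * zeta (Suc n) = - alpha_conj n"
proof (induction n)
  case 0
  have "zeta 0 - of_int \<lfloor>zeta 0\<rfloor> = omega D - of_int a0"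
    unfolding floor_zeta_0 by (simp add: zeta_0 omega_eq)
  with a0_bounds alpha_seq_1 alpha_seq_0 show ?case by (simp add: zeta_Suc field_simps)
next
  case (Suc n)
  have z: "zeta (Suc (Suc n)) = 1 / (zeta (Suc n) - of_int (u_coeff D (Suc n)))"
    unfolding u_coeff_eq by (rule zeta_Suc)
  have "zeta (Suc (Suc n)) > 1" using reduced_zeta unfolding reduced_def reduced_repr_def by blast
  then have nz: "zeta (Suc n) - of_int (u_coeff D (Suc n)) \<noteq> 0" using z by auto
  have "alpha_conj (Suc (Suc n)) = - alpha_conj (Suc n) * (zeta (Suc n) - of_int (u_coeff D (Suc n)))"
    using alpha_conj_rec[of n] Suc by (simp add: algebra_simps)
  then show ?case unfolding z using nz by simp
qed

lemma alpha_conj_sign: "alpha_conj (2 * m) > 0 \<and> alpha_conj (2 * m + 1) < 0"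
proof -
  have flip: "alpha_conj n > 0 \<longleftrightarrow> alpha_conj (Suc n) < 0" "alpha_conj n < 0 \<longleftrightarrow> alpha_conj (Suc n) > 0" for n
  proof -
    have z: "zeta (Suc n) > 1" using reduced_zeta unfolding reduced_def reduced_repr_def by blast
    have "alpha_conj n = - (alpha_conj (Suc n) * zeta (Suc n))" using alpha_conj_zeta[of n] by simp
    with z show "alpha_conj n > 0 \<longleftrightarrow> alpha_conj (Suc n) < 0" "alpha_conj n < 0 \<longleftrightarrow> alpha_conj (Suc n) > 0"
      by (auto simp: mult_less_0_iff zero_less_mult_iff)
  qed
  show ?thesis
  proof (induction m)
    case 0
    then show ?case using alpha_seq_0 flip(1)[of 0] by simp
  next
    case (Suc m)
    then show ?case using flip(2)[of "2 * m + 1"] flip(1)[of "2 * m + 2"] by simp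
  qed
qed

lemma index_pair_form:
  "\<exists>m r. index_pair D n = (2 * int m - 1, r) \<and> 0 \<le> r \<and> r < u_coeff D (2 * m + 1)"
proof (induction n)
  case 0
  then show ?case using u_coeff_ge_1[of 1] by (intro exI[of _ 0]) auto
next
  case (Suc n)
  then obtain m r where mr: "index_pair D n = (2 * int m - 1, r)" "0 \<le> r" "r < u_coeff D (2 * m + 1)"
    by blast
  have e: "nat (2 * int m - 1 + 2) = 2 * m + 1" by linarith
  show ?case
  proof (cases "r + 1 \<le> u_coeff D (2 * m + 1) - 1")
    case True
    with mr e show ?thesis by (intro exI[of _ m] exI[of _ "r + 1"]) simp
  next
    case False
    with mr e u_coeff_ge_1[of "2 * Suc m + 1"] show ?thesis
      by (intro exI[of _ "Suc m"] exI[of _ 0]) simp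
  qed
qed

text \<open>With \<open>alpha_seq\<close> for \<open>X\<close> this is \<open>\<beta>\<close> at
  \<open>n\<close>, with \<open>alpha_conj\<close> it is \<open>\<beta>\<close> at
  \<open>- n\<close>; one recurrence proof serves both.\<close>

definition ladder :: "(nat \<Rightarrow> real) \<Rightarrow> nat \<Rightarrow> real" where
  "ladder X n = (case index_pair D n of (i, r) \<Rightarrow> X (nat (i + 1)) + of_int r * X (nat (i + 2)))"

lemma ladder_eq:
  "index_pair D n = (2 * int m - 1, r) \<Longrightarrow> ladder X n = X (2 * m) + of_int r * X (2 * m + 1)"
proof -
  have "nat (2 * int m - 1 + 1) = 2 * m" "nat (2 * int m - 1 + 2) = 2 * m + 1" by linarith+
  then show "index_pair D n = (2 * int m - 1, r) \<Longrightarrow> ?thesis" by (simp add: ladder_def)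
qed

text \<open>At the end of a block, the recurrence of \<open>X\<close> identifies the next term with
  the start of the following block.\<close>

lemma ladder_Suc:
  assumes "\<And>n. X (n + 2) = of_int (u_coeff D (n + 1)) * X (n + 1) + X n"
    and mr: "index_pair D n = (2 * int m - 1, r)"
  shows "ladder X (Suc n) = ladder X n + X (2 * m + 1)"
proof -
  from index_pair_form[of n] mr have r: "0 \<le> r" "r < u_coeff D (2 * m + 1)" by auto
  have e: "nat (2 * int m - 1 + 2) = 2 * m + 1" by linarith
  show ?thesis
  proof (cases "r + 1 \<le> u_coeff D (2 * m + 1) - 1")
    case True
    then have "index_pair D (Suc n) = (2 * int m - 1, r + 1)" using mr e by simp
    with mr show ?thesis by (simp add: ladder_eq algebra_simps)
  next
    case False
    then have "index_pair D (Suc n) = (2 * int (Suc m) - 1, 0)" using mr e by simp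
    moreover have "u_coeff D (2 * m + 1) = r + 1" using False r by simp
    ultimately show ?thesis
      using assms(1)[of "2 * m"] unfolding ladder_eq[OF mr] by (simp only: ladder_eq) (simp add: algebra_simps)
  qed
qed

lemma v_coeff_int:
  "index_pair D n = (i, r) \<Longrightarrow> v_coeff D (int n) = (if r = 0 then u_coeff D (nat (i + 1)) + 2 else 2)"
  by (simp add: v_coeff_def)

text \<open>Second differences vanish inside a block. At a block start the increment changes from
  \<open>X (2 * m + 1)\<close> to \<open>X (2 * m + 3)\<close>, that is by
  \<open>u_coeff D (2 * m + 2) * X (2 * m + 2)\<close>.\<close>

lemma ladder_recurrence:
  assumes X: "\<And>n. X (n + 2) = of_int (u_coeff D (n + 1)) * X (n + 1) + X n"
  shows "of_int (v_coeff D (int (Suc n))) * ladder X (Suc n) = ladder X n + ladder X (Suc (Suc n))"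
proof -
  obtain m r where mr: "index_pair D n = (2 * int m - 1, r)" "0 \<le> r" "r < u_coeff D (2 * m + 1)"
    using index_pair_form by blast
  have e: "nat (2 * int m - 1 + 2) = 2 * m + 1" "nat (2 * int (Suc m) - 1 + 1) = 2 * m + 2"
    using nat_int[of "2 * m + 1"] nat_int[of "2 * m + 2"] by (simp_all add: algebra_simps)
  note step = ladder_Suc[of X, OF X]
  have s1: "ladder X (Suc n) = ladder X n + X (2 * m + 1)" by (rule step[OF mr(1)])
  show ?thesis
  proof (cases "r + 1 \<le> u_coeff D (2 * m + 1) - 1")
    case True
    then have i: "index_pair D (Suc n) = (2 * int m - 1, r + 1)" using mr e by simp
    then have "v_coeff D (int (Suc n)) = 2" using mr(2) v_coeff_int[OF i] by simp
    with s1 step[OF i] show ?thesis by simp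
  next
    case False
    then have i: "index_pair D (Suc n) = (2 * int (Suc m) - 1, 0)" using mr e by simp
    then have v: "v_coeff D (int (Suc n)) = u_coeff D (2 * m + 2) + 2"
      using v_coeff_int[OF i] unfolding e by simp
    have "ladder X (Suc n) = X (2 * m + 2)" using ladder_eq[OF i] by simp
    moreover have "X (2 * m + 3) = of_int (u_coeff D (2 * m + 2)) * X (2 * m + 2) + X (2 * m + 1)"
      using X[of "2 * m + 1"] by (simp add: numeral_eq_Suc)
    moreover have "ladder X (Suc (Suc n)) = ladder X (Suc n) + X (2 * m + 3)"
      using step[OF i] by (simp add: numeral_eq_Suc)
    ultimately show ?thesis using s1 v by (simp add: algebra_simps)
  qed
qed

lemma v_coeff_ge_2: "v_coeff D j \<ge> 2"
proof -
  obtain i r where "index_pair D (nat \<bar>j\<bar>) = (i, r)" by fastforce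
  then show ?thesis using u_coeff_ge_1[of "nat (i + 1)"] by (simp add: v_coeff_def)
qed

lemma ladder_0: "ladder alpha_seq 0 = 1" "ladder alpha_conj 0 = 1"
  by (simp_all add: ladder_def alpha_seq_0)

lemma ladder_1: "ladder alpha_seq 1 = 1 + of_int a0 + xi D" "ladder alpha_conj 1 = 1 + of_int a0 - omega D"
  using ladder_Suc[of alpha_seq 0 0 0] alpha_seq_rec ladder_Suc[of alpha_conj 0 0 0] alpha_conj_rec ladder_0 alpha_seq_1
  by simp_all

lemma ladder_alpha_coords:
  "\<exists>a b :: int. ladder alpha_seq n = of_int a + of_int b * xi D \<and> ladder alpha_conj n = of_int a - of_int b * omega D"
proof -
  obtain m r where mr: "index_pair D n = (2 * int m - 1, r)" using index_pair_form by blast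
  then show ?thesis
    by (intro exI[of _ "p_shift D (2 * m) + r * p_shift D (2 * m + 1)"]
          exI[of _ "q_shift D (2 * m) + r * q_shift D (2 * m + 1)"])
       (simp add: ladder_eq alpha_seq_def alpha_conj_def algebra_simps)
qed

lemma conjugate_ladder: "conjugate D (ladder alpha_seq n) = ladder alpha_conj n"
  using ladder_alpha_coords[of n] conjugate_xi by auto

lemma beta_nonneg: "beta D (int n) = ladder alpha_seq n"
proof -
  obtain m r where mr: "index_pair D n = (2 * int m - 1, r)" using index_pair_form by blast
  have e: "nat (2 * int m - 1 + 1) = 2 * m" "nat (2 * int m - 1 + 1 + 1) = 2 * m + 1" by linarith+
  have "beta D (int n) = alpha2 D (2 * int m - 1) r" using mr by (simp add: beta_def)
  then show ?thesis unfolding alpha2_def alpha_def e ladder_eq[OF mr] alpha_seq_def by simp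
qed

lemma beta_nonpos: "beta D (- int n) = ladder alpha_conj n"
proof (cases "n = 0")
  case True
  then show ?thesis using beta_nonneg[of 0] ladder_0 by simp
next
  case False
  obtain i r where "index_pair D n = (i, r)" by fastforce
  then have "beta D (- int n) = conjugate D (beta D (int n))"
    using False by (simp add: beta_def)
  then show ?thesis by (simp add: beta_nonneg conjugate_ladder)
qed

lemma v_coeff_minus: "v_coeff D (- j) = v_coeff D j"
  by (simp add: v_coeff_def)

lemma beta_coords:
  "\<exists>a b :: int. beta D j = of_int a + of_int b * xi D \<and> beta D (- j) = of_int a - of_int b * omega D"
proof (cases j rule: int_cases2)
  case (nonneg n)
  then show ?thesis using ladder_alpha_coords[of n] by (simp add: beta_nonneg beta_nonpos)
next
  case (nonpos n)
  obtain a b :: int where "ladder alpha_seq n = of_int a + of_int b * xi D"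
      "ladder alpha_conj n = of_int a - of_int b * omega D"
    using ladder_alpha_coords by blast
  \<comment> \<open>For a negative index the conjugate comes first, and \<open>omega D\<close> is
    rewritten through \<open>xi D\<close>.\<close>
  then show ?thesis using nonpos
    by (intro exI[of _ "a - b * omega_trace"] exI[of _ "- b"])
       (simp add: beta_nonneg beta_nonpos omega_eq algebra_simps)
qed

text \<open>Away from 0 this is the ladder recurrence. At 0 the neighbours add up to
  \<open>2 + 2 * a0 + xi D - omega D\<close>, which is \<open>u_coeff D 0 + 2\<close>.\<close>

lemma beta_recurrence: "of_int (v_coeff D j) * beta D j = beta D (j - 1) + beta D (j + 1)"
proof (cases j rule: int_cases2)
  case (nonneg n)
  show ?thesis
  proof (cases n)
    case 0
    have "beta D 1 = ladder alpha_seq 1" "beta D (- 1) = ladder alpha_conj 1"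
      using beta_nonneg[of 1] beta_nonpos[of 1] by simp_all
    moreover have "beta D 0 = 1" using beta_nonneg[of 0] ladder_0 by simp
    moreover have "v_coeff D 0 = 2 * a0 - omega_trace + 2" by (simp add: v_coeff_def u_coeff_0)
    ultimately show ?thesis using nonneg 0 ladder_1 by (simp add: omega_eq)
  next
    case (Suc k)
    have "j = int (Suc k)" "j - 1 = int k" "j + 1 = int (Suc (Suc k))" using nonneg Suc by simp_all
    then show ?thesis using ladder_recurrence[of alpha_seq k, OF alpha_seq_rec] by (simp only: beta_nonneg)
  qed
next
  case (nonpos n)
  show ?thesis
  proof (cases n)
    case 0
    have "beta D 1 = ladder alpha_seq 1" "beta D (- 1) = ladder alpha_conj 1"
      using beta_nonneg[of 1] beta_nonpos[of 1] by simp_all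
    moreover have "beta D 0 = 1" using beta_nonneg[of 0] ladder_0 by simp
    moreover have "v_coeff D 0 = 2 * a0 - omega_trace + 2" by (simp add: v_coeff_def u_coeff_0)
    ultimately show ?thesis using nonpos 0 ladder_1 by (simp add: omega_eq)
  next
    case (Suc k)
    have j: "j = - int (Suc k)" "j + 1 = - int k" "j - 1 = - int (Suc (Suc k))"
      using nonpos Suc by simp_all
    show ?thesis using ladder_recurrence[of alpha_conj k, OF alpha_conj_rec]
      unfolding j(2,3) unfolding j(1) by (simp only: beta_nonpos v_coeff_minus add.commute)
  qed
qed

sublocale beta_chain "beta D" "v_coeff D"
proof
  fix a b j :: int
  show "v_coeff D j \<ge> 2" by (rule v_coeff_ge_2)
  show "of_int (v_coeff D j) * beta D j = beta D (j - 1) + beta D (j + 1)" by (rule beta_recurrence)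
  assume "of_int a * beta D 0 + of_int b * beta D 1 = 0"
  then have "of_int (a + b * (1 + a0)) + of_int b * xi D = 0"
    using beta_nonneg[of 0] beta_nonneg[of 1] ladder_0 ladder_1 by (simp add: algebra_simps)
  from xi_independent[OF this] show "a = 0 \<and> b = 0" by auto
qed

section \<open>Positivity, and the cones covering the totally positive integers\<close>

lemma ladder_alpha_ge: "ladder alpha_seq n \<ge> of_int (int n) * xi D"
proof (induction n)
  case 0
  then show ?case by (simp add: ladder_0)
next
  case (Suc n)
  obtain m r where mr: "index_pair D n = (2 * int m - 1, r)" using index_pair_form by blast
  have "ladder alpha_seq (Suc n) = ladder alpha_seq n + alpha_seq (2 * m + 1)" by (rule ladder_Suc[OF alpha_seq_rec mr])
  moreover have "alpha_seq (2 * m + 1) \<ge> xi D" using alpha_seq_ge[of "2 * m"] by simp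
  ultimately show ?case using Suc by (simp add: algebra_simps)
qed

lemma ladder_alpha_pos: "ladder alpha_seq n > 0"
  using ladder_alpha_ge[of n] a0_bounds(4) ladder_0
  by (cases "n = 0") (auto intro: less_le_trans[rotated])

text \<open>The conjugates descend from 1; within each block they stay above the positive start of
  the next one.\<close>

lemma ladder_conj_bounds: "0 < ladder alpha_conj n \<and> ladder alpha_conj n \<le> 1"
proof
  obtain m r where mr: "index_pair D n = (2 * int m - 1, r)" "0 \<le> r" "r < u_coeff D (2 * m + 1)"
    using index_pair_form by blast
  have "alpha_conj (2 * m + 1) < 0" "alpha_conj (2 * Suc m) > 0" using alpha_conj_sign by blast+
  moreover have "of_int (u_coeff D (2 * m + 1)) * alpha_conj (2 * m + 1) \<le> of_int r * alpha_conj (2 * m + 1)"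
    using mr alpha_conj_sign[of m] by (intro mult_right_mono_neg) auto
  moreover have "alpha_conj (2 * Suc m)
      = of_int (u_coeff D (2 * m + 1)) * alpha_conj (2 * m + 1) + alpha_conj (2 * m)"
    using alpha_conj_rec[of "2 * m"] by simp
  ultimately show "0 < ladder alpha_conj n" unfolding ladder_eq[OF mr(1)] by linarith
  show "ladder alpha_conj n \<le> 1"
  proof (induction n)
    case (Suc n)
    obtain m r where mr: "index_pair D n = (2 * int m - 1, r)" using index_pair_form by blast
    have "ladder alpha_conj (Suc n) = ladder alpha_conj n + alpha_conj (2 * m + 1)"
      by (rule ladder_Suc[OF alpha_conj_rec mr])
    with Suc alpha_conj_sign[of m] show ?case by simp
  qed (simp add: ladder_0)
qed

lemma beta_pos: "beta D j > 0"
  by (cases j rule: int_cases2)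
     (simp_all add: beta_nonneg beta_nonpos ladder_alpha_pos ladder_conj_bounds)

text \<open>The recurrence preserves the determinant of consecutive terms and their
  conjugates.\<close>

lemma beta_det:
  "beta D j * beta D (- (j + 1)) - beta D (- j) * beta D (j + 1) = - (omega D + xi D)"
proof (induction j rule: int_induct[where k = 0])
  case base
  show ?case using beta_nonneg[of 0] beta_nonneg[of 1] beta_nonpos[of 1] ladder_0 ladder_1 by simp
next
  case (step1 j)
  have "beta D (- (j + 1 + 1)) = of_int (v_coeff D (j + 1)) * beta D (- (j + 1)) - beta D (- j)"
  proof -
    have "- (j + 1) - 1 = - (j + 1 + 1)" "- (j + 1) + 1 = - j" by simp_all
    then show ?thesis using beta_recurrence[of "- (j + 1)"] unfolding v_coeff_minus by simp
  qed
  moreover have "beta D (j + 1 + 1) = of_int (v_coeff D (j + 1)) * beta D (j + 1) - beta D j"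
    using beta_recurrence[of "j + 1"] by simp
  ultimately show ?case using step1 by (simp only:) (simp add: algebra_simps)
next
  case (step2 j)
  have m: "beta D (- (j - 1)) = of_int (v_coeff D j) * beta D (- j) - beta D (- (j + 1))"
    using beta_recurrence[of "- j"] by (simp add: v_coeff_minus)
  have p: "beta D (j - 1) = of_int (v_coeff D j) * beta D j - beta D (j + 1)"
    using beta_recurrence[of j] by simp
  have e: "j - 1 + 1 = j" by simp
  show ?case using step2 unfolding e m p by (simp add: algebra_simps)
qed

lemma totally_positive_iff:
  "x \<in> totally_positive_ints D \<longleftrightarrow>
    (\<exists>j e f. e \<ge> 1 \<and> f \<ge> 0 \<and> x = of_int e * beta D j + of_int f * beta D (j + 1))"
proof
  assume "x \<in> totally_positive_ints D"
  then obtain a b :: int where x: "x = of_int a + of_int b * xi D" and pos: "x > 0" "conjugate D x > 0"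
    by (auto simp: totally_positive_ints_def ring_of_ints_iff)
  define y where "y = conjugate D x"
  have "x = of_int (a - b * (1 + a0)) * beta D 0 + of_int b * beta D 1"
    using x beta_nonneg[of 0] beta_nonneg[of 1] ladder_0 ladder_1 by (simp add: algebra_simps)
  then obtain g where g: "\<And>j. x = of_int (g j) * beta D j - of_int (g (j - 1)) * beta D (j + 1)"
    by (rule coord_sequence_exists) blast
  have y: "y = of_int (g j) * beta D (- j) - of_int (g (j - 1)) * beta D (- (j + 1))" for j
  proof -
    obtain c d :: int where c: "beta D j = of_int c + of_int d * xi D" "beta D (- j) = of_int c - of_int d * omega D"
      using beta_coords by blast
    obtain c' d' :: int where c': "beta D (j + 1) = of_int c' + of_int d' * xi D"
      "beta D (- (j + 1)) = of_int c' - of_int d' * omega D"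
      using beta_coords by blast
    have "x = of_int (g j * c - g (j - 1) * c') + of_int (g j * d - g (j - 1) * d') * xi D"
      using g[of j] unfolding c c' by (simp add: algebra_simps)
    then have "y = of_int (g j * c - g (j - 1) * c') - of_int (g j * d - g (j - 1) * d') * omega D"
      unfolding y_def by (simp only: conjugate_xi)
    then show ?thesis unfolding c c' by (simp add: algebra_simps)
  qed
  have det: "x * beta D (- (j + 1)) - y * beta D (j + 1) = - of_int (g j) * (omega D + xi D)" for j
  proof -
    have "x * beta D (- (j + 1)) - y * beta D (j + 1)
      = of_int (g j) * (beta D j * beta D (- (j + 1)) - beta D (- j) * beta D (j + 1))"
      by (subst g[of j], subst y[of j]) (simp add: algebra_simps)
    then show ?thesis unfolding beta_det by (simp only: mult_minus_left mult_minus_right)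
  qed
  have w: "omega D + xi D > 0" using a0_bounds by linarith
  have yp: "y > 0" using pos by (simp add: y_def)
  \<comment> \<open>The terms grow at least linearly while their conjugates stay at most 1, which
    fixes the sign of \<open>g\<close> far out on both sides.\<close>
  have large: "\<exists>n. p * ladder alpha_conj n < q * ladder alpha_seq n" if "p > 0" "q > 0" for p q :: real
  proof -
    obtain n :: nat where n: "p / (q * xi D) < real n" using reals_Archimedean2 by blast
    then have "p < q * (of_int (int n) * xi D)" using that a0_bounds(4) by (simp add: field_simps)
    also have "\<dots> \<le> q * ladder alpha_seq n" using that ladder_alpha_ge[of n] by simp
    finally have "p < q * ladder alpha_seq n" .
    moreover have "p * ladder alpha_conj n \<le> p" using that ladder_conj_bounds[of n] by simp
    ultimately show ?thesis by (intro exI[of _ n]) linarith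
  qed
  obtain n1 where n1: "x * ladder alpha_conj n1 < y * ladder alpha_seq n1" using large pos(1) yp by blast
  obtain n2 where n2: "y * ladder alpha_conj n2 < x * ladder alpha_seq n2" using large pos(1) yp by blast
  \<comment> \<open>The determinant for \<open>g j\<close> involves \<open>j + 1\<close>, hence the
    shift by one.\<close>
  have "- of_int (g (int n1 - 1)) * (omega D + xi D) < 0"
    using det[of "int n1 - 1"] n1 by (simp add: beta_nonneg beta_nonpos)
  then have g1: "g (int n1 - 1) > 0" using w by (simp add: zero_less_mult_iff)
  have "- of_int (g (- int n2 - 1)) * (omega D + xi D) > 0"
    using det[of "- int n2 - 1"] n2 by (simp add: beta_nonneg beta_nonpos)
  then have g2: "g (- int n2 - 1) < 0" using w by (simp add: mult_less_0_iff)
  \<comment> \<open>The first positive value of \<open>g\<close> after a negative one; its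
    predecessor is at most 0, so both coordinates have the right sign.\<close>
  define k where "k = (LEAST k. g (- int n2 - 1 + int k) > 0)"
  have k: "g (- int n2 - 1 + int k) > 0"
    unfolding k_def
  proof (rule LeastI)
    show "g (- int n2 - 1 + int (n1 + n2)) > 0" using g1 by simp
  qed
  with g2 have "k \<noteq> 0" by (intro notI) simp
  then have "\<not> g (- int n2 - 1 + int (k - 1)) > 0"
    unfolding k_def by (intro not_less_Least) simp
  with \<open>k \<noteq> 0\<close> have "g (- int n2 - 1 + int k - 1) \<le> 0" by (simp add: of_nat_diff algebra_simps)
  with k g[of "- int n2 - 1 + int k"]
  show "\<exists>j e f. e \<ge> 1 \<and> f \<ge> 0 \<and> x = of_int e * beta D j + of_int f * beta D (j + 1)"
    by (intro exI[of _ "- int n2 - 1 + int k"] exI[of _ "g (- int n2 - 1 + int k)"]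
          exI[of _ "- g (- int n2 - 1 + int k - 1)"]) simp
next
  assume "\<exists>j e f. e \<ge> 1 \<and> f \<ge> 0 \<and> x = of_int e * beta D j + of_int f * beta D (j + 1)"
  then obtain j e f where ef: "e \<ge> 1" "f \<ge> 0" and x: "x = of_int e * beta D j + of_int f * beta D (j + 1)"
    by blast
  obtain c d :: int where c: "beta D j = of_int c + of_int d * xi D" "beta D (- j) = of_int c - of_int d * omega D"
    using beta_coords by blast
  obtain c' d' :: int where c': "beta D (j + 1) = of_int c' + of_int d' * xi D"
    "beta D (- (j + 1)) = of_int c' - of_int d' * omega D"
    using beta_coords by blast
  have xc: "x = of_int (e * c + f * c') + of_int (e * d + f * d') * xi D"
    unfolding x c c' by (simp add: algebra_simps)
  have "conjugate D x = of_int (e * c + f * c') - of_int (e * d + f * d') * omega D"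
    unfolding xc by (rule conjugate_xi)
  then have "conjugate D x = of_int e * beta D (- j) + of_int f * beta D (- (j + 1))"
    unfolding c c' by (simp add: algebra_simps)
  \<comment> \<open>Used for \<open>x\<close> itself and, with negated indices, for its
    conjugate.\<close>
  moreover have "of_int e * beta D i + of_int f * beta D k > 0" for i k
    using ef beta_pos[of i] beta_pos[of k] by (intro add_pos_nonneg mult_pos_pos mult_nonneg_nonneg) auto
  moreover have "x \<in> ring_of_ints D" using xc ring_of_ints_iff by blast
  ultimately show "x \<in> totally_positive_ints D" by (simp only: totally_positive_ints_def x) simp
qed

lemma indecomposables_eq: "indecomposables D = range (beta D)"
  unfolding indecomposables_def by (rule indecomposables_eq_range) (rule totally_positive_iff)

end

theorem theorem6p1:
  fixes D :: nat and \<alpha> :: real and j e f :: int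
  assumes "D \<ge> 2" and "squarefree D"
    and "\<alpha> \<in> totally_positive_ints D"
    and "e \<ge> 1" and "f \<ge> 0"
    and "\<alpha> = of_int e * beta D j + of_int f * beta D (j + 1)"
  shows "num_partitions (indecomposables D) \<alpha> = 2 \<longleftrightarrow>
     (v_coeff D j \<le> e \<and> e \<le> 2 * v_coeff D j - 1 \<and> 0 \<le> f \<and> f \<le> v_coeff D (j + 1) - 2
        \<and> (e, f) \<noteq> (2 * v_coeff D j - 1, v_coeff D (j + 1) - 2)
        \<and> (v_coeff D (j - 1), e) \<noteq> (2, 2 * v_coeff D j - 1)
        \<and> (v_coeff D (j - 1), e, f) \<noteq> (2, 2 * v_coeff D j - 2, v_coeff D (j + 1) - 2))
   \<or> (1 \<le> e \<and> e \<le> v_coeff D j - 2 \<and> v_coeff D (j + 1) \<le> f \<and> f \<le> 2 * v_coeff D (j + 1) - 1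
        \<and> (e, f) \<noteq> (v_coeff D j - 2, 2 * v_coeff D (j + 1) - 1)
        \<and> (f, v_coeff D (j + 2)) \<noteq> (2 * v_coeff D (j + 1) - 1, 2)
        \<and> (e, f, v_coeff D (j + 2)) \<noteq> (v_coeff D j - 2, 2 * v_coeff D (j + 1) - 2, 2))
   \<or> (e = v_coeff D j - 1 \<and> f = v_coeff D (j + 1) - 1
        \<and> (v_coeff D (j - 1), v_coeff D j, v_coeff D (j + 1), v_coeff D (j + 2)) \<noteq> (2, 2, 2, 2))"
proof -
  interpret real_quadratic D by unfold_locales fact+
  show ?thesis
    unfolding indecomposables_eq assms(6) num_partitions_range[OF assms(4)]
    by (rule card_reps_eq_2_iff[OF assms(4,5)])
qed

end
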